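(* Let $H$ be a central ideal of a diassociative algebra $L$ over a field $\mathbb{F}$, let $0\to H\to L\xrightarrow{\beta}L/H\to0$ be the natural central extension with a section $\mu$ of $\beta$, and let $A$ be a central $L$-module. Then the sequence $$0\to \mathrm{Hom}(L/H,A)\xrightarrow{\mathrm{Inf}_1}\mathrm{Hom}(L,A)\xrightarrow{\mathrm{Res}}\mathrm{Hom}(H,A)\xrightarrow{\mathrm{Tra}}\mathcal{H}^2(L/H,A)\xrightarrow{\mathrm{Inf}_2}\mathcal{H}^2(L,A)$$ is exact.
   Context: A diassociative algebra over a field $\mathbb{F}$ is an $\mathbb{F}$-vector space with two associative bilinear products $\dashv,\vdash$ satisfying $x\dashv(y\dashv z)=x\dashv(y\vdash z)$, $(x\vdash y)\dashv z=x\vdash(y\dashv z)$, $(x\dashv y)\vdash z=(x\vdash y)\vdash z$. The center $Z(L)$ is the set of $z\in L$ with $z\dashv x=x\dashv z=z\vdash x=x\vdash z=0$ for all $x\in L$; a central ideal is an ideal contained in $Z(L)$. A section of $\beta$ is a linear map $\mu$ with $\beta\circ\mu=\mathrm{id}$. A central $L$-module $A$ is a vector space on which $L$ acts by zero, regarded as a diassociative algebra with zero products; $\mathrm{Hom}(\cdot,A)$ denotes diassociative algebra homomorphisms into $A$. For a diassociative algebra $B$, $\mathcal{Z}^2(B,A)$ is the space of pairs $(f_\dashv,f_\vdash)$ of bilinear maps $B\times B\to A$ such that for all $i,j,k\in B$: $f_\dashv(i,j\dashv k)=f_\dashv(i,j\vdash k)$; $f_\dashv(i\vdash j,k)=f_\vdash(i,j\dashv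 k)$; $f_\vdash(i\dashv j,k)=f_\vdash(i\vdash j,k)$; $f_\dashv(i,j\dashv k)=f_\dashv(i\dashv j,k)$; $f_\vdash(i,j\vdash k)=f_\vdash(i\vdash j,k)$. $\mathcal{B}^2(B,A)$ is the subspace of pairs with $f_\dashv(i,j)=-\varepsilon(i\dashv j)$, $f_\vdash(i,j)=-\varepsilon(i\vdash j)$ for some linear $\varepsilon:B\to A$. $\mathcal{H}^2(B,A)=\mathcal{Z}^2(B,A)/\mathcal{B}^2(B,A)$. The maps: $\mathrm{Inf}_1(\chi)=\chi\circ\beta$. $\mathrm{Res}(\pi)=\pi\circ\iota$ with $\iota:H\to L$ the inclusion. $\mathrm{Tra}(\chi)$ is the class of $(\chi\circ f_\dashv,\chi\circ f_\vdash)$, where $f_\dashv,f_\vdash:L/H\times L/H\to H$ are $f_\dashv(\bar x,\bar y)=\mu(\bar x)\dashv\mu(\bar y)-\mu(\bar x\dashv\bar y)$ and $f_\vdash(\bar x,\bar y)=\mu(\bar x)\vdash\mu(\bar y)-\mu(\bar x\vdash\bar y)$ (the class does not depend on the section). $\mathrm{Inf}_2$ sends the class of $(f_\dashv,f_\vdash)$ to the class of $(f'_\dashv,f'_\vdash)$ with $f'_\dashv(x,y)=f_\dashv(\beta(x),\beta(y))$ and $f'_\vdash(x,y)=f_\vdash(\beta(x),\beta(y))$ for $x,y\in L$. *)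

theory Defs
  imports "HOL-Algebra.Module" "HOL-Algebra.QuotRing"
begin

section \<open>Vector spaces, linear maps, quotients\<close>

text \<open>
  A vector space is a \<^locale>\<open>module\<close> over a \<^locale>\<open>field\<close>. The record type
  \<^typ>\<open>('a, 'b) module\<close> inherits the fields \<^const>\<open>mult\<close> and \<^const>\<open>one\<close> from rings;
  the locale \<^locale>\<open>module\<close> ignores them, and they are left undefined in the constructions below.
  Maps are extensional functions on carriers, so that equality of maps is equality of HOL functions.
\<close>

locale vec_space = field F + module F V for F (structure) and V (structure)

definition linear_maps ::
  "('f, 'r) ring_scheme \<Rightarrow> ('f, 'v, 'm) module_scheme \<Rightarrow> ('f, 'w, 'n) module_scheme \<Rightarrow> ('v \<Rightarrow> 'w) set"
  where "linear_maps F V W =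
    {f \<in> carrier V \<rightarrow>\<^sub>E carrier W.
       (\<forall>x\<in>carrier V. \<forall>y\<in>carrier V. f (x \<oplus>\<^bsub>V\<^esub> y) = f x \<oplus>\<^bsub>W\<^esub> f y) \<and>
       (\<forall>a\<in>carrier F. \<forall>x\<in>carrier V. f (a \<odot>\<^bsub>V\<^esub> x) = a \<odot>\<^bsub>W\<^esub> f x)}"

locale linear_map = V: vec_space F V + W: vec_space F W
  for F (structure) and V (structure) and W (structure) and f +
  assumes linear: "f \<in> linear_maps F V W"

definition bilinear_maps ::
  "('f, 'r) ring_scheme \<Rightarrow> ('f, 'v, 'm) module_scheme \<Rightarrow> ('f, 'w, 'n) module_scheme \<Rightarrow>
    ('v \<times> 'v \<Rightarrow> 'w) set"
  where "bilinear_maps F V W =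
    {f \<in> carrier V \<times> carrier V \<rightarrow>\<^sub>E carrier W.
       \<forall>x\<in>carrier V. (\<lambda>y\<in>carrier V. f (x, y)) \<in> linear_maps F V W \<and>
                      (\<lambda>y\<in>carrier V. f (y, x)) \<in> linear_maps F V W}"

text \<open>As for \<^const>\<open>FactRing\<close>: when the operation is well defined on cosets, all
  the cosets in the union coincide.\<close>

definition FactModule ::
  "('f, 'v, 'm) module_scheme \<Rightarrow> 'v set \<Rightarrow> ('f, 'v set) module"
  where "FactModule V U =
    \<lparr>carrier = a_rcosets\<^bsub>V\<^esub> U, mult = undefined, one = undefined, zero = U, add = set_add V,
     smult = (\<lambda>a X. \<Union>x\<in>X. U +>\<^bsub>V\<^esub> (a \<odot>\<^bsub>V\<^esub> x))\<rparr>"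

definition zero_module :: "('f, unit) module"
  where "zero_module =
    \<lparr>carrier = {()}, mult = undefined, one = undefined, zero = (), add = (\<lambda>_ _. ()),
     smult = (\<lambda>_ _. ())\<rparr>"

text \<open>Exactness of \<open>U \<rightarrow> V \<rightarrow> W\<close> at \<open>V\<close>, in the category of vector spaces over \<open>F\<close>.\<close>

definition exact_at ::
  "('f, 'r) ring_scheme \<Rightarrow> ('f, 'u, 'l) module_scheme \<Rightarrow> ('u \<Rightarrow> 'v) \<Rightarrow>
    ('f, 'v, 'm) module_scheme \<Rightarrow> ('v \<Rightarrow> 'w) \<Rightarrow> ('f, 'w, 'n) module_scheme \<Rightarrow> bool"
  where "exact_at F U f V g W \<longleftrightarrow>
    linear_map F U V f \<and> linear_map F V W g \<and> f ` carrier U = a_kernel V W g"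


section \<open>Diassociative algebras\<close>

record ('f, 'a) dialgebra = "('f, 'a) module" +
  lprod :: "'a \<Rightarrow> 'a \<Rightarrow> 'a" (infixl \<open>\<stileturn>\<index>\<close> 70)
  rprod :: "'a \<Rightarrow> 'a \<Rightarrow> 'a" (infixl \<open>\<turnstile>\<index>\<close> 70)

locale diassociative_algebra = vec_space F L for F (structure) and L (structure) +
  assumes lprod_bilinear:
      "(\<lambda>(x, y)\<in>carrier L \<times> carrier L. x \<stileturn>\<^bsub>L\<^esub> y) \<in> bilinear_maps F L L"
    and rprod_bilinear:
      "(\<lambda>(x, y)\<in>carrier L \<times> carrier L. x \<turnstile>\<^bsub>L\<^esub> y) \<in> bilinear_maps F L L"
    and lprod_assoc: "\<lbrakk>x \<in> carrier L; y \<in> carrier L; z \<in> carrier L\<rbrakk> \<Longrightarrow>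
      (x \<stileturn>\<^bsub>L\<^esub> y) \<stileturn>\<^bsub>L\<^esub> z = x \<stileturn>\<^bsub>L\<^esub> (y \<stileturn>\<^bsub>L\<^esub> z)"
    and rprod_assoc: "\<lbrakk>x \<in> carrier L; y \<in> carrier L; z \<in> carrier L\<rbrakk> \<Longrightarrow>
      (x \<turnstile>\<^bsub>L\<^esub> y) \<turnstile>\<^bsub>L\<^esub> z = x \<turnstile>\<^bsub>L\<^esub> (y \<turnstile>\<^bsub>L\<^esub> z)"
    and left_bar: "\<lbrakk>x \<in> carrier L; y \<in> carrier L; z \<in> carrier L\<rbrakk> \<Longrightarrow>
      x \<stileturn>\<^bsub>L\<^esub> (y \<stileturn>\<^bsub>L\<^esub> z) = x \<stileturn>\<^bsub>L\<^esub> (y \<turnstile>\<^bsub>L\<^esub> z)"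
    and inner_assoc: "\<lbrakk>x \<in> carrier L; y \<in> carrier L; z \<in> carrier L\<rbrakk> \<Longrightarrow>
      (x \<turnstile>\<^bsub>L\<^esub> y) \<stileturn>\<^bsub>L\<^esub> z = x \<turnstile>\<^bsub>L\<^esub> (y \<stileturn>\<^bsub>L\<^esub> z)"
    and right_bar: "\<lbrakk>x \<in> carrier L; y \<in> carrier L; z \<in> carrier L\<rbrakk> \<Longrightarrow>
      (x \<stileturn>\<^bsub>L\<^esub> y) \<turnstile>\<^bsub>L\<^esub> z = (x \<turnstile>\<^bsub>L\<^esub> y) \<turnstile>\<^bsub>L\<^esub> z"

definition dialgebra_hom ::
  "('f, 'r) ring_scheme \<Rightarrow> ('f, 'a, 'm) dialgebra_scheme \<Rightarrow> ('f, 'b, 'n) dialgebra_scheme \<Rightarrow>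
    ('a \<Rightarrow> 'b) set"
  where "dialgebra_hom F L M =
    {f \<in> linear_maps F L M. \<forall>x\<in>carrier L. \<forall>y\<in>carrier L.
       f (x \<stileturn>\<^bsub>L\<^esub> y) = f x \<stileturn>\<^bsub>M\<^esub> f y \<and> f (x \<turnstile>\<^bsub>L\<^esub> y) = f x \<turnstile>\<^bsub>M\<^esub> f y}"

definition center :: "('f, 'a, 'm) dialgebra_scheme \<Rightarrow> 'a set"
  where "center L =
    {z \<in> carrier L. \<forall>x\<in>carrier L.
       z \<stileturn>\<^bsub>L\<^esub> x = \<zero>\<^bsub>L\<^esub> \<and> x \<stileturn>\<^bsub>L\<^esub> z = \<zero>\<^bsub>L\<^esub> \<and> z \<turnstile>\<^bsub>L\<^esub> x = \<zero>\<^bsub>L\<^esub> \<and> x \<turnstile>\<^bsub>L\<^esub> z = \<zero>\<^bsub>L\<^esub>}"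

locale dialgebra_ideal = submodule H F L for H and F (structure) and L (structure) +
  assumes ideal_closed: "\<lbrakk>h \<in> H; x \<in> carrier L\<rbrakk> \<Longrightarrow>
    h \<stileturn>\<^bsub>L\<^esub> x \<in> H \<and> x \<stileturn>\<^bsub>L\<^esub> h \<in> H \<and> h \<turnstile>\<^bsub>L\<^esub> x \<in> H \<and> x \<turnstile>\<^bsub>L\<^esub> h \<in> H"

locale central_ideal = dialgebra_ideal +
  assumes central: "H \<subseteq> center L"

definition FactDialgebra :: "('f, 'a, 'm) dialgebra_scheme \<Rightarrow> 'a set \<Rightarrow> ('f, 'a set) dialgebra"
  where "FactDialgebra L H = module.extend (FactModule L H)
    (dialgebra.fields
      (\<lambda>X Y. \<Union>x\<in>X. \<Union>y\<in>Y. H +>\<^bsub>L\<^esub> (x \<stileturn>\<^bsub>L\<^esub> y))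
      (\<lambda>X Y. \<Union>x\<in>X. \<Union>y\<in>Y. H +>\<^bsub>L\<^esub> (x \<turnstile>\<^bsub>L\<^esub> y)))"

definition quot_map :: "('f, 'a, 'm) dialgebra_scheme \<Rightarrow> 'a set \<Rightarrow> 'a \<Rightarrow> 'a set"
  where "quot_map L H = (\<lambda>x\<in>carrier L. H +>\<^bsub>L\<^esub> x)"

definition is_section ::
  "('f, 'r) ring_scheme \<Rightarrow> ('f, 'a, 'm) dialgebra_scheme \<Rightarrow> 'a set \<Rightarrow> ('a set \<Rightarrow> 'a) \<Rightarrow> bool"
  where "is_section F L H \<mu> \<longleftrightarrow>
    \<mu> \<in> linear_maps F (FactDialgebra L H) L \<and>
    (\<forall>X\<in>carrier (FactDialgebra L H). quot_map L H (\<mu> X) = X)"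

text \<open>A central module of a diassociative algebra is a vector space without further data: the
  action is zero, and so are its products when it is regarded as a diassociative algebra.\<close>

definition zero_products :: "('f, 'a) module \<Rightarrow> ('f, 'a) dialgebra"
  where "zero_products A =
    module.extend A (dialgebra.fields (\<lambda>_ _. \<zero>\<^bsub>A\<^esub>) (\<lambda>_ _. \<zero>\<^bsub>A\<^esub>))"


section \<open>Homomorphism spaces and second cohomology with central coefficients\<close>

definition Hom ::
  "('f, 'r) ring_scheme \<Rightarrow> ('f, 'b, 'm) dialgebra_scheme \<Rightarrow> ('f, 'a) module \<Rightarrow>
    ('f, 'b \<Rightarrow> 'a) module"
  where "Hom F B A =
    \<lparr>carrier = dialgebra_hom F B (zero_products A), mult = undefined, one = undefined,
     zero = (\<lambda>x\<in>carrier B. \<zero>\<^bsub>A\<^esub>),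
     add = (\<lambda>f g. \<lambda>x\<in>carrier B. f x \<oplus>\<^bsub>A\<^esub> g x),
     smult = (\<lambda>c f. \<lambda>x\<in>carrier B. c \<odot>\<^bsub>A\<^esub> f x)\<rparr>"

type_synonym ('b, 'a) cochain2 = "('b \<times> 'b \<Rightarrow> 'a) \<times> ('b \<times> 'b \<Rightarrow> 'a)"

definition cocycles2 ::
  "('f, 'r) ring_scheme \<Rightarrow> ('f, 'b, 'm) dialgebra_scheme \<Rightarrow> ('f, 'a) module \<Rightarrow>
    ('b, 'a) cochain2 set"
  where "cocycles2 F B A =
    {(f, g) \<in> bilinear_maps F B A \<times> bilinear_maps F B A.
       \<forall>i\<in>carrier B. \<forall>j\<in>carrier B. \<forall>k\<in>carrier B.
         f (i, j \<stileturn>\<^bsub>B\<^esub> k) = f (i, j \<turnstile>\<^bsub>B\<^esub> k) \<and>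
         f (i \<turnstile>\<^bsub>B\<^esub> j, k) = g (i, j \<stileturn>\<^bsub>B\<^esub> k) \<and>
         g (i \<stileturn>\<^bsub>B\<^esub> j, k) = g (i \<turnstile>\<^bsub>B\<^esub> j, k) \<and>
         f (i, j \<stileturn>\<^bsub>B\<^esub> k) = f (i \<stileturn>\<^bsub>B\<^esub> j, k) \<and>
         g (i, j \<turnstile>\<^bsub>B\<^esub> k) = g (i \<turnstile>\<^bsub>B\<^esub> j, k)}"

definition Z2 ::
  "('f, 'r) ring_scheme \<Rightarrow> ('f, 'b, 'm) dialgebra_scheme \<Rightarrow> ('f, 'a) module \<Rightarrow>
    ('f, ('b, 'a) cochain2) module"
  where "Z2 F B A =
    \<lparr>carrier = cocycles2 F B A, mult = undefined, one = undefined,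
     zero = (\<lambda>p\<in>carrier B \<times> carrier B. \<zero>\<^bsub>A\<^esub>, \<lambda>p\<in>carrier B \<times> carrier B. \<zero>\<^bsub>A\<^esub>),
     add = (\<lambda>(f, g) (f', g').
       (\<lambda>p\<in>carrier B \<times> carrier B. f p \<oplus>\<^bsub>A\<^esub> f' p, \<lambda>p\<in>carrier B \<times> carrier B. g p \<oplus>\<^bsub>A\<^esub> g' p)),
     smult = (\<lambda>c (f, g).
       (\<lambda>p\<in>carrier B \<times> carrier B. c \<odot>\<^bsub>A\<^esub> f p, \<lambda>p\<in>carrier B \<times> carrier B. c \<odot>\<^bsub>A\<^esub> g p))\<rparr>"

definition B2 ::
  "('f, 'r) ring_scheme \<Rightarrow> ('f, 'b, 'm) dialgebra_scheme \<Rightarrow> ('f, 'a) module \<Rightarrow>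
    ('b, 'a) cochain2 set"
  where "B2 F B A =
    {(\<lambda>(i, j)\<in>carrier B \<times> carrier B. \<ominus>\<^bsub>A\<^esub> \<epsilon> (i \<stileturn>\<^bsub>B\<^esub> j),
      \<lambda>(i, j)\<in>carrier B \<times> carrier B. \<ominus>\<^bsub>A\<^esub> \<epsilon> (i \<turnstile>\<^bsub>B\<^esub> j)) | \<epsilon>. \<epsilon> \<in> linear_maps F B A}"

definition H2 ::
  "('f, 'r) ring_scheme \<Rightarrow> ('f, 'b, 'm) dialgebra_scheme \<Rightarrow> ('f, 'a) module \<Rightarrow>
    ('f, ('b, 'a) cochain2 set) module"
  where "H2 F B A = FactModule (Z2 F B A) (B2 F B A)"

definition cohomology_class ::
  "('f, 'r) ring_scheme \<Rightarrow> ('f, 'b, 'm) dialgebra_scheme \<Rightarrow> ('f, 'a) module \<Rightarrow>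
    ('b, 'a) cochain2 \<Rightarrow> ('b, 'a) cochain2 set"
  where "cohomology_class F B A \<phi> = B2 F B A +>\<^bsub>Z2 F B A\<^esub> \<phi>"


section \<open>The maps of the sequence\<close>

text \<open>The ideal \<open>H\<close> as a diassociative algebra is \<^term>\<open>L\<lparr>carrier := H\<rparr>\<close>.\<close>

definition Inf1 ::
  "('f, 'r) ring_scheme \<Rightarrow> ('f, 'l, 'm) dialgebra_scheme \<Rightarrow> 'l set \<Rightarrow> ('f, 'a) module \<Rightarrow>
    ('l set \<Rightarrow> 'a) \<Rightarrow> ('l \<Rightarrow> 'a)"
  where "Inf1 F L H A =
    (\<lambda>\<chi>\<in>carrier (Hom F (FactDialgebra L H) A). compose (carrier L) \<chi> (quot_map L H))"

definition Res ::
  "('f, 'r) ring_scheme \<Rightarrow> ('f, 'l, 'm) dialgebra_scheme \<Rightarrow> 'l set \<Rightarrow> ('f, 'a) module \<Rightarrow>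
    ('l \<Rightarrow> 'a) \<Rightarrow> ('l \<Rightarrow> 'a)"
  where "Res F L H A = (\<lambda>\<pi>\<in>carrier (Hom F L A). restrict \<pi> H)"

definition Tra ::
  "('f, 'r) ring_scheme \<Rightarrow> ('f, 'l, 'm) dialgebra_scheme \<Rightarrow> 'l set \<Rightarrow> ('l set \<Rightarrow> 'l) \<Rightarrow>
    ('f, 'a) module \<Rightarrow> ('l \<Rightarrow> 'a) \<Rightarrow> ('l set, 'a) cochain2 set"
  where "Tra F L H \<mu> A =
    (\<lambda>\<chi>\<in>carrier (Hom F (L\<lparr>carrier := H\<rparr>) A).
       let Q = FactDialgebra L H;
           f = (\<lambda>(X, Y). \<mu> X \<stileturn>\<^bsub>L\<^esub> \<mu> Y \<ominus>\<^bsub>L\<^esub> \<mu> (X \<stileturn>\<^bsub>Q\<^esub> Y));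
           g = (\<lambda>(X, Y). \<mu> X \<turnstile>\<^bsub>L\<^esub> \<mu> Y \<ominus>\<^bsub>L\<^esub> \<mu> (X \<turnstile>\<^bsub>Q\<^esub> Y))
       in cohomology_class F Q A
            (compose (carrier Q \<times> carrier Q) \<chi> f, compose (carrier Q \<times> carrier Q) \<chi> g))"

text \<open>The image of a class is the class of the image of any representative; as in
  \<^const>\<open>FactModule\<close>, it is written as the union over all representatives.\<close>

definition Inf2 ::
  "('f, 'r) ring_scheme \<Rightarrow> ('f, 'l, 'm) dialgebra_scheme \<Rightarrow> 'l set \<Rightarrow> ('f, 'a) module \<Rightarrow>
    ('l set, 'a) cochain2 set \<Rightarrow> ('l, 'a) cochain2 set"
  where "Inf2 F L H A =
    (\<lambda>X\<in>carrier (H2 F (FactDialgebra L H) A). \<Union>(f, g)\<in>X.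
       cohomology_class F L A
         (\<lambda>(x, y)\<in>carrier L \<times> carrier L. f (quot_map L H x, quot_map L H y),
          \<lambda>(x, y)\<in>carrier L \<times> carrier L. g (quot_map L H x, quot_map L H y)))"

end

(*  Composing p : L \<rightarrow> A (linear) with the products of lifts \<mu> X, \<mu> Y gives a cocycle
    c(p) on L/H, because products in L only depend on cosets modulo the central ideal H. For
    \<chi> : H \<rightarrow> A put p_\<chi> = \<chi> o (id - \<mu> o \<beta>), an extension of \<chi> to L; then Tra \<chi> is the
    class of c(p_\<chi>), and the inflation of any c(p) is the coboundary of -p.
    If c(p_\<chi>) is the coboundary of \<epsilon>, then p_\<chi> + \<epsilon> o \<beta> is a homomorphism on L restricting
    to \<chi>. If the inflation of \<phi> is the coboundary of \<epsilon>, then \<phi> = c(-\<epsilon>), which differs from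
    c(p_\<chi>) for \<chi> = -\<epsilon>|H by the coboundary of \<epsilon> o \<mu>. *)

theory Submission
  imports Defs
begin

section \<open>Vector spaces\<close>

text \<open>The section \<mu> is linear but not multiplicative: the lift of a product and the
  product of the lifts differ by an element of H. Centrality makes this difference invisible inside
  any further product, so the cocycle identities for c(p) hold exactly and not merely up to a
  correction. The transgression evaluates \<chi> only at elements w - \<mu> (\<beta> w), where w is
  a product of two lifts. Since id - \<mu> o \<beta> projects L linearly onto H, passing from \<chi>
  to p_\<chi> replaces a map on H by a linear map on all of L evaluated at products. Homomorphisms
  into A (zero on products) and coboundaries (minus a linear map on products) are tested at the same
  places, so all comparisons become pointwise identities. The minus signs come from the sign in the
  definition of a coboundary. The rest is encoding. Exactness is stated between vector spaces, so
  the spaces of homomorphisms and classes must first be shown to be such, as subspaces of function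
  spaces and quotients of these. Operations on cosets are unions over representatives and cannot be
  computed before they are known to be well defined.\<close>

lemma vec_spaceI:
  assumes "field F" "module F V"
  shows "vec_space F V"
  using assms by (simp add: vec_space_def)

text \<open>The axioms only involve these four fields, so they pass between records of different
  type. This carries them from \<open>FactModule\<close> to \<open>FactDialgebra\<close> and from a
  subspace of \<open>fun_space\<close> to \<open>Hom\<close>.\<close>

lemma vec_space_cong:
  assumes "vec_space F V" and eq: "carrier W = carrier V" "add W = add V" "zero W = zero V"
    "smult W = smult V"
  shows "vec_space F W"
proof -
  interpret V: vec_space F V by fact
  show ?thesis
  proof (intro vec_spaceI moduleI abelian_groupI)
    fix x assume "x \<in> carrier W"
    then show "\<exists>y\<in>carrier W. y \<oplus>\<^bsub>W\<^esub> x = \<zero>\<^bsub>W\<^esub>"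
      unfolding eq using V.M.l_neg V.M.a_inv_closed by blast
  qed (auto simp: eq V.field_axioms V.is_cring V.M.a_assoc V.smult_l_distr V.smult_r_distr
      V.smult_assoc1 intro: V.M.a_comm)
qed

lemma zero_module_vec_space: "field F \<Longrightarrow> vec_space F zero_module"
  by (intro vec_spaceI moduleI abelian_groupI) (auto simp: zero_module_def field_def domain_def)

text \<open>Negation is scaling by -1, so closure under inverses comes from closure under
  scaling.\<close>

lemma (in vec_space) submoduleI':
  assumes sub: "U \<subseteq> carrier V" and "\<zero>\<^bsub>V\<^esub> \<in> U"
    and "\<And>x y. \<lbrakk>x \<in> U; y \<in> U\<rbrakk> \<Longrightarrow> x \<oplus>\<^bsub>V\<^esub> y \<in> U"
    and smult: "\<And>a x. \<lbrakk>a \<in> carrier F; x \<in> U\<rbrakk> \<Longrightarrow> a \<odot>\<^bsub>V\<^esub> x \<in> U"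
  shows "submodule U F V"
proof (rule submoduleI)
  fix x assume x: "x \<in> U"
  then have "\<ominus>\<^bsub>V\<^esub> x = (\<ominus>\<^bsub>F\<^esub> \<one>\<^bsub>F\<^esub>) \<odot>\<^bsub>V\<^esub> x"
    using sub by (auto simp: smult_l_minus)
  then show "\<ominus>\<^bsub>V\<^esub> x \<in> U" using smult x by simp
qed (use assms in auto)

lemma (in vec_space) submodule_vec_space:
  assumes "submodule U F V"
  shows "vec_space F (V\<lparr>carrier := U\<rparr>)"
  using assms by (intro vec_spaceI field_axioms submodule.submodule_is_module module_axioms)

lemma linear_mapsI:
  assumes "f \<in> extensional (carrier V)"
    and "\<And>x. x \<in> carrier V \<Longrightarrow> f x \<in> carrier W"
    and "\<And>x y. \<lbrakk>x \<in> carrier V; y \<in> carrier V\<rbrakk> \<Longrightarrow> f (x \<oplus>\<^bsub>V\<^esub> y) = f x \<oplus>\<^bsub>W\<^esub> f y"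
    and "\<And>a x. \<lbrakk>a \<in> carrier F; x \<in> carrier V\<rbrakk> \<Longrightarrow> f (a \<odot>\<^bsub>V\<^esub> x) = a \<odot>\<^bsub>W\<^esub> f x"
  shows "f \<in> linear_maps F V W"
  using assms by (auto simp: linear_maps_def PiE_def)

lemma linear_mapI:
  assumes "vec_space F V" "vec_space F W" "f \<in> linear_maps F V W"
  shows "linear_map F V W f"
  using assms by (simp add: linear_map_def linear_map_axioms_def)

context linear_map
begin

lemma map_ext: "f \<in> extensional (carrier V)"
  and map_closed [simp, intro]: "x \<in> carrier V \<Longrightarrow> f x \<in> carrier W"
  and map_add: "\<lbrakk>x \<in> carrier V; y \<in> carrier V\<rbrakk> \<Longrightarrow> f (x \<oplus>\<^bsub>V\<^esub> y) = f x \<oplus>\<^bsub>W\<^esub> f y"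
  and map_smult: "\<lbrakk>a \<in> carrier F; x \<in> carrier V\<rbrakk> \<Longrightarrow> f (a \<odot>\<^bsub>V\<^esub> x) = a \<odot>\<^bsub>W\<^esub> f x"
  using linear by (auto simp: linear_maps_def PiE_def)

lemma map_zero [simp]: "f \<zero>\<^bsub>V\<^esub> = \<zero>\<^bsub>W\<^esub>"
proof -
  have "f (\<zero>\<^bsub>F\<^esub> \<odot>\<^bsub>V\<^esub> \<zero>\<^bsub>V\<^esub>) = \<zero>\<^bsub>F\<^esub> \<odot>\<^bsub>W\<^esub> f \<zero>\<^bsub>V\<^esub>" by (intro map_smult) auto
  then show ?thesis by simp
qed

lemma map_neg: "x \<in> carrier V \<Longrightarrow> f (\<ominus>\<^bsub>V\<^esub> x) = \<ominus>\<^bsub>W\<^esub> f x"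
  using map_smult[of "\<ominus>\<^bsub>F\<^esub> \<one>\<^bsub>F\<^esub>" x] by (simp add: V.smult_l_minus W.smult_l_minus)

lemma map_minus: "\<lbrakk>x \<in> carrier V; y \<in> carrier V\<rbrakk> \<Longrightarrow> f (x \<ominus>\<^bsub>V\<^esub> y) = f x \<ominus>\<^bsub>W\<^esub> f y"
  by (simp add: a_minus_def map_add map_neg)

lemma submodule_image: "submodule (f ` carrier V) F W"
proof (rule W.submoduleI')
  show "\<zero>\<^bsub>W\<^esub> \<in> f ` carrier V" by (rule image_eqI[of _ _ "\<zero>\<^bsub>V\<^esub>"]) simp_all
qed (auto simp: map_add[symmetric] map_smult[symmetric])

end

lemma linear_maps_compose:
  assumes "vec_space F U" and f: "f \<in> linear_maps F U V" and g: "g \<in> linear_maps F V W"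
  shows "compose (carrier U) g f \<in> linear_maps F U W"
proof -
  interpret U: vec_space F U by fact
  show ?thesis using f g by (auto simp: linear_maps_def compose_def PiE_def Pi_def)
qed

lemma linear_maps_restrict:
  assumes "f \<in> linear_maps F V W" "submodule U F V"
  shows "restrict f U \<in> linear_maps F (V\<lparr>carrier := U\<rparr>) W"
proof -
  interpret U: submodule U F V by fact
  show ?thesis
    using assms(1) U.subset U.m_closed U.smult_closed
    by (auto simp: linear_maps_def subset_iff)
qed

section \<open>Quotient spaces\<close>

locale quotient_space = vec_space F V + submodule U F V for F (structure) and V (structure) and U
begin

sublocale abelian_subgroup U V
  by (intro abelian_subgroupI3 additive_subgroup.intro subgroup_axioms M.abelian_group_axioms)

lemma coset_eq_iff:
  assumes "x \<in> carrier V" "y \<in> carrier V"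
  shows "U +>\<^bsub>V\<^esub> x = U +>\<^bsub>V\<^esub> y \<longleftrightarrow> x \<ominus>\<^bsub>V\<^esub> y \<in> U"
proof -
  have "U +>\<^bsub>V\<^esub> x = U +>\<^bsub>V\<^esub> y \<longleftrightarrow> x \<in> U +>\<^bsub>V\<^esub> y"
    using assms a_repr_independence'[of x y] a_rcos_self[of x] by auto
  then show ?thesis
    using assms a_rcos_module[of y x] by (simp add: a_minus_def)
qed

lemma coset_eq_self_iff: "x \<in> carrier V \<Longrightarrow> U +>\<^bsub>V\<^esub> x = U \<longleftrightarrow> x \<in> U"
  using a_rcos_const[of x] a_rcos_self[of x] by auto

lemma carrier_quotient: "carrier (FactModule V U) = (\<lambda>x. U +>\<^bsub>V\<^esub> x) ` carrier V"
  by (auto simp: FactModule_def A_RCOSETS_def')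

lemma quotientE:
  assumes "X \<in> carrier (FactModule V U)"
  obtains x where "x \<in> carrier V" "X = U +>\<^bsub>V\<^esub> x"
  using assms by (auto simp: carrier_quotient)

lemma mem_coset_iff: "x \<in> carrier V \<Longrightarrow> y \<in> U +>\<^bsub>V\<^esub> x \<longleftrightarrow> y \<in> carrier V \<and> y \<ominus>\<^bsub>V\<^esub> x \<in> U"
  using a_elemrcos_carrier[of x y] a_rcos_module[of x y] by (auto simp: a_minus_def)

text \<open>The tool for evaluating operations written as unions over representatives. A family that
  is constant along the coset collapses to its common value; the coset contains its representative,
  so the union is not empty.\<close>

lemma UN_coset:
  assumes "x \<in> carrier V"
    and "\<And>y. \<lbrakk>y \<in> carrier V; y \<ominus>\<^bsub>V\<^esub> x \<in> U\<rbrakk> \<Longrightarrow> g y = g x"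
  shows "(\<Union>y\<in>U +>\<^bsub>V\<^esub> x. g y) = g x"
proof -
  have "g y = g x" if "y \<in> U +>\<^bsub>V\<^esub> x" for y
    using that assms(2)[of y] by (simp add: mem_coset_iff assms(1))
  then show ?thesis using a_rcos_self[OF assms(1)] by blast
qed

lemma zero_quotient: "\<zero>\<^bsub>FactModule V U\<^esub> = U"
  by (simp add: FactModule_def)

text \<open>With zero in coset form, every axiom of the quotient reduces to an equation between
  representatives.\<close>

lemma zero_quotient_coset: "\<zero>\<^bsub>FactModule V U\<^esub> = U +>\<^bsub>V\<^esub> \<zero>\<^bsub>V\<^esub>"
  by (simp add: zero_quotient a_subset)

lemma add_quotient:
  "\<lbrakk>x \<in> carrier V; y \<in> carrier V\<rbrakk> \<Longrightarrow> (U +>\<^bsub>V\<^esub> x) \<oplus>\<^bsub>FactModule V U\<^esub> (U +>\<^bsub>V\<^esub> y) = U +>\<^bsub>V\<^esub> (x \<oplus>\<^bsub>V\<^esub> y)"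
  by (simp add: FactModule_def a_rcos_sum)

lemma smult_minus: "\<lbrakk>a \<in> carrier F; x \<in> carrier V; y \<in> carrier V\<rbrakk> \<Longrightarrow>
    a \<odot>\<^bsub>V\<^esub> x \<ominus>\<^bsub>V\<^esub> a \<odot>\<^bsub>V\<^esub> y = a \<odot>\<^bsub>V\<^esub> (x \<ominus>\<^bsub>V\<^esub> y)"
  by (simp add: a_minus_def smult_r_distr smult_r_minus)

lemma smult_quotient:
  "\<lbrakk>a \<in> carrier F; x \<in> carrier V\<rbrakk> \<Longrightarrow> a \<odot>\<^bsub>FactModule V U\<^esub> (U +>\<^bsub>V\<^esub> x) = U +>\<^bsub>V\<^esub> (a \<odot>\<^bsub>V\<^esub> x)"
proof -
  assume a: "a \<in> carrier F" and x: "x \<in> carrier V"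
  have "(\<Union>y\<in>U +>\<^bsub>V\<^esub> x. U +>\<^bsub>V\<^esub> (a \<odot>\<^bsub>V\<^esub> y)) = U +>\<^bsub>V\<^esub> (a \<odot>\<^bsub>V\<^esub> x)"
  proof (rule UN_coset[OF x])
    fix y assume "y \<in> carrier V" "y \<ominus>\<^bsub>V\<^esub> x \<in> U"
    then show "U +>\<^bsub>V\<^esub> (a \<odot>\<^bsub>V\<^esub> y) = U +>\<^bsub>V\<^esub> (a \<odot>\<^bsub>V\<^esub> x)"
      using a x by (subst coset_eq_iff) (simp_all add: smult_minus)
  qed
  then show ?thesis by (simp add: FactModule_def)
qed

lemma quotient_vec_space: "vec_space F (FactModule V U)"
proof (intro vec_spaceI moduleI abelian_groupI)
  fix X assume "X \<in> carrier (FactModule V U)"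
  then obtain x where x: "x \<in> carrier V" "X = U +>\<^bsub>V\<^esub> x" by (rule quotientE)
  then show "\<exists>Y\<in>carrier (FactModule V U). Y \<oplus>\<^bsub>FactModule V U\<^esub> X = \<zero>\<^bsub>FactModule V U\<^esub>"
    by (intro bexI[of _ "U +>\<^bsub>V\<^esub> \<ominus>\<^bsub>V\<^esub> x"])
      (auto simp: add_quotient carrier_quotient zero_quotient_coset M.l_neg)
qed (auto elim!: quotientE simp: field_axioms is_cring add_quotient smult_quotient carrier_quotient
      zero_quotient_coset smult_l_distr smult_r_distr smult_assoc1 M.a_assoc M.a_comm M.a_lcomm)

lemma coset_linear: "(\<lambda>x\<in>carrier V. U +>\<^bsub>V\<^esub> x) \<in> linear_maps F V (FactModule V U)"
  by (rule linear_mapsI) (auto simp: carrier_quotient add_quotient smult_quotient)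

end

text \<open>Two representatives differ by an element of \<open>U\<close>, which \<phi> sends into
  \<open>T\<close>, so the coset of the image does not change. This is the well-definedness of the
  induced map, in the union form in which \<open>Inf2\<close> is given.\<close>

lemma UN_induced:
  assumes "quotient_space F V U" "quotient_space F W T" "linear_map F V W \<phi>"
    and sub: "\<phi> ` U \<subseteq> T" and x: "x \<in> carrier V"
  shows "(\<Union>y\<in>U +>\<^bsub>V\<^esub> x. T +>\<^bsub>W\<^esub> \<phi> y) = T +>\<^bsub>W\<^esub> \<phi> x"
proof -
  interpret U: quotient_space F V U by fact
  interpret T: quotient_space F W T by fact
  interpret \<phi>: linear_map F V W \<phi> by fact
  show ?thesis
  proof (rule U.UN_coset[OF x])
    fix y assume "y \<in> carrier V" "y \<ominus>\<^bsub>V\<^esub> x \<in> U"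
    then show "T +>\<^bsub>W\<^esub> \<phi> y = T +>\<^bsub>W\<^esub> \<phi> x"
      using x sub by (subst T.coset_eq_iff) (auto simp: \<phi>.map_minus[symmetric])
  qed
qed

lemma induced_linear:
  assumes "quotient_space F V U" "quotient_space F W T" "linear_map F V W \<phi>"
    and sub: "\<phi> ` U \<subseteq> T"
  shows "(\<lambda>X\<in>carrier (FactModule V U). \<Union>y\<in>X. T +>\<^bsub>W\<^esub> \<phi> y)
    \<in> linear_maps F (FactModule V U) (FactModule W T)"
proof -
  interpret U: quotient_space F V U by fact
  interpret T: quotient_space F W T by fact
  interpret \<phi>: linear_map F V W \<phi> by fact
  note UN = UN_induced[OF assms]
  have coset: "x \<in> carrier V \<Longrightarrow> U +>\<^bsub>V\<^esub> x \<in> carrier (FactModule V U)" for x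
    by (simp add: U.carrier_quotient)
  show ?thesis (is "?f \<in> _")
  proof (rule linear_mapsI)
    fix X Y assume "X \<in> carrier (FactModule V U)" "Y \<in> carrier (FactModule V U)"
    then obtain x y where "x \<in> carrier V" "X = U +>\<^bsub>V\<^esub> x" "y \<in> carrier V" "Y = U +>\<^bsub>V\<^esub> y"
      by (auto elim!: U.quotientE)
    then show "?f (X \<oplus>\<^bsub>FactModule V U\<^esub> Y) = ?f X \<oplus>\<^bsub>FactModule W T\<^esub> ?f Y"
      by (simp add: U.add_quotient T.add_quotient UN coset \<phi>.map_add)
  next
    fix a X assume "a \<in> carrier F" "X \<in> carrier (FactModule V U)"
    then obtain x where "a \<in> carrier F" "x \<in> carrier V" "X = U +>\<^bsub>V\<^esub> x"
      by (auto elim!: U.quotientE)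
    then show "?f (a \<odot>\<^bsub>FactModule V U\<^esub> X) = a \<odot>\<^bsub>FactModule W T\<^esub> ?f X"
      by (simp add: U.smult_quotient T.smult_quotient UN coset \<phi>.map_smult)
  qed (auto elim!: U.quotientE simp: UN coset T.carrier_quotient)
qed

section \<open>Function spaces and products\<close>

text \<open>An ambient space with the pointwise operations of \<open>Hom\<close> and, on pairs, of
  \<open>Z2\<close>: the vector space axioms are checked once here, and only closure conditions
  remain for those spaces.\<close>

definition fun_space :: "'s set \<Rightarrow> ('f, 'a, 'm) module_scheme \<Rightarrow> ('f, 's \<Rightarrow> 'a) module"
  where "fun_space S A =
    \<lparr>carrier = S \<rightarrow>\<^sub>E carrier A, mult = undefined, one = undefined,
     zero = (\<lambda>x\<in>S. \<zero>\<^bsub>A\<^esub>),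
     add = (\<lambda>f g. \<lambda>x\<in>S. f x \<oplus>\<^bsub>A\<^esub> g x),
     smult = (\<lambda>c f. \<lambda>x\<in>S. c \<odot>\<^bsub>A\<^esub> f x)\<rparr>"

lemma (in vec_space) fun_space_vec_space: "vec_space F (fun_space S V)"
proof (intro vec_spaceI moduleI abelian_groupI)
  fix f assume f: "f \<in> carrier (fun_space S V)"
  show "\<exists>g\<in>carrier (fun_space S V). g \<oplus>\<^bsub>fun_space S V\<^esub> f = \<zero>\<^bsub>fun_space S V\<^esub>"
    using f by (intro bexI[of _ "\<lambda>x\<in>S. \<ominus>\<^bsub>V\<^esub> f x"])
      (auto simp: fun_space_def PiE_def Pi_def M.l_neg intro!: restrict_ext)
qed (auto simp: fun_space_def PiE_def Pi_def fun_eq_iff extensional_def field_axioms is_cring a_assoc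
      smult_l_distr smult_r_distr smult_assoc1 intro: a_comm)

definition prod_space ::
  "('f, 'v, 'm) module_scheme \<Rightarrow> ('f, 'w, 'n) module_scheme \<Rightarrow> ('f, 'v \<times> 'w) module"
  where "prod_space V W =
    \<lparr>carrier = carrier V \<times> carrier W, mult = undefined, one = undefined,
     zero = (\<zero>\<^bsub>V\<^esub>, \<zero>\<^bsub>W\<^esub>),
     add = (\<lambda>(x, y) (x', y'). (x \<oplus>\<^bsub>V\<^esub> x', y \<oplus>\<^bsub>W\<^esub> y')),
     smult = (\<lambda>c (x, y). (c \<odot>\<^bsub>V\<^esub> x, c \<odot>\<^bsub>W\<^esub> y))\<rparr>"

lemma prod_space_vec_space:
  assumes "vec_space F V" "vec_space F W"
  shows "vec_space F (prod_space V W)"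
proof -
  interpret V: vec_space F V by fact
  interpret W: vec_space F W by fact
  show ?thesis
  proof (intro vec_spaceI moduleI abelian_groupI)
    fix p assume p: "p \<in> carrier (prod_space V W)"
    show "\<exists>q\<in>carrier (prod_space V W). q \<oplus>\<^bsub>prod_space V W\<^esub> p = \<zero>\<^bsub>prod_space V W\<^esub>"
      using p by (intro bexI[of _ "(\<ominus>\<^bsub>V\<^esub> fst p, \<ominus>\<^bsub>W\<^esub> snd p)"])
        (auto simp: prod_space_def V.l_neg W.l_neg)
  qed (auto simp: prod_space_def V.field_axioms V.is_cring V.a_assoc W.a_assoc
      V.smult_l_distr V.smult_r_distr V.smult_assoc1 W.smult_l_distr W.smult_r_distr W.smult_assoc1
      intro: V.a_comm W.a_comm)
qed

lemma linear_maps_submodule: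
  assumes "vec_space F V" "vec_space F W"
  shows "submodule (linear_maps F V W) F (fun_space (carrier V) W)"
proof -
  interpret V: vec_space F V by fact
  interpret W: vec_space F W by fact
  interpret S: vec_space F "fun_space (carrier V) W" by (rule W.fun_space_vec_space)
  show ?thesis
  proof (rule S.submoduleI')
    show "linear_maps F V W \<subseteq> carrier (fun_space (carrier V) W)"
      by (auto simp: linear_maps_def fun_space_def)
    show "\<zero>\<^bsub>fun_space (carrier V) W\<^esub> \<in> linear_maps F V W"
      by (rule linear_mapsI) (auto simp: fun_space_def)
  next
    fix f g assume "f \<in> linear_maps F V W" "g \<in> linear_maps F V W"
    then interpret f: linear_map F V W f + g: linear_map F V W g
      using assms by (auto intro: linear_mapI)
    show "f \<oplus>\<^bsub>fun_space (carrier V) W\<^esub> g \<in> linear_maps F V W"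
      by (rule linear_mapsI)
        (auto simp: fun_space_def f.map_add g.map_add f.map_smult g.map_smult W.smult_r_distr W.M.a_ac)
  next
    fix a f assume a: "a \<in> carrier F" and "f \<in> linear_maps F V W"
    then interpret f: linear_map F V W f using assms by (auto intro: linear_mapI)
    \<comment> \<open>Commutativity of the field interchanges the scalar \<open>a\<close> with the
      one in the linearity condition.\<close>
    show "a \<odot>\<^bsub>fun_space (carrier V) W\<^esub> f \<in> linear_maps F V W"
      by (rule linear_mapsI)
        (auto simp: a fun_space_def f.map_add f.map_smult W.smult_r_distr W.smult_assoc1[symmetric]
          V.m_comm)
  qed
qed

text \<open>Closure of the carrier of \<open>V\<close> under its operations lets the restricted
  partial maps of the definition be evaluated, which leaves plain equations for rewriting.\<close>

lemma bilinear_maps_iff: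
  assumes "vec_space F V"
  shows "f \<in> bilinear_maps F V W \<longleftrightarrow>
    f \<in> carrier V \<times> carrier V \<rightarrow>\<^sub>E carrier W \<and>
    (\<forall>x\<in>carrier V. \<forall>y\<in>carrier V. \<forall>z\<in>carrier V.
       f (x, y \<oplus>\<^bsub>V\<^esub> z) = f (x, y) \<oplus>\<^bsub>W\<^esub> f (x, z) \<and> f (y \<oplus>\<^bsub>V\<^esub> z, x) = f (y, x) \<oplus>\<^bsub>W\<^esub> f (z, x)) \<and>
    (\<forall>a\<in>carrier F. \<forall>x\<in>carrier V. \<forall>y\<in>carrier V.
       f (x, a \<odot>\<^bsub>V\<^esub> y) = a \<odot>\<^bsub>W\<^esub> f (x, y) \<and> f (a \<odot>\<^bsub>V\<^esub> y, x) = a \<odot>\<^bsub>W\<^esub> f (y, x))"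
proof -
  interpret V: vec_space F V by fact
  show ?thesis
    unfolding bilinear_maps_def linear_maps_def
    by (simp add: PiE_def Pi_def) blast
qed

lemma bilinear_maps_submodule:
  assumes "vec_space F V" "vec_space F W"
  shows "submodule (bilinear_maps F V W) F (fun_space (carrier V \<times> carrier V) W)"
proof -
  interpret V: vec_space F V by fact
  interpret W: vec_space F W by fact
  interpret S: vec_space F "fun_space (carrier V \<times> carrier V) W" by (rule W.fun_space_vec_space)
  note iff = bilinear_maps_iff[OF assms(1)]
  show ?thesis
  proof (rule S.submoduleI')
    show "bilinear_maps F V W \<subseteq> carrier (fun_space (carrier V \<times> carrier V) W)"
      by (simp add: bilinear_maps_def fun_space_def)
    show "\<zero>\<^bsub>fun_space (carrier V \<times> carrier V) W\<^esub> \<in> bilinear_maps F V W"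
      by (auto simp: iff fun_space_def)
  next
    fix f g assume "f \<in> bilinear_maps F V W" "g \<in> bilinear_maps F V W"
    then show "f \<oplus>\<^bsub>fun_space (carrier V \<times> carrier V) W\<^esub> g \<in> bilinear_maps F V W"
      unfolding iff by (simp add: fun_space_def W.smult_r_distr W.M.a_ac PiE_def Pi_def)
  next
    fix a f assume "a \<in> carrier F" "f \<in> bilinear_maps F V W"
    then show "a \<odot>\<^bsub>fun_space (carrier V \<times> carrier V) W\<^esub> f \<in> bilinear_maps F V W"
      unfolding iff
      by (simp add: fun_space_def W.smult_r_distr W.smult_assoc1[symmetric] V.m_comm PiE_def Pi_def)
  qed
qed

section \<open>Diassociative algebras\<close>

context diassociative_algebra
begin

lemma
  shows lprod_closed [simp, intro]:
      "\<lbrakk>x \<in> carrier L; y \<in> carrier L\<rbrakk> \<Longrightarrow> x \<stileturn>\<^bsub>L\<^esub> y \<in> carrier L"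
    and lprod_add_right: "\<lbrakk>x \<in> carrier L; y \<in> carrier L; z \<in> carrier L\<rbrakk> \<Longrightarrow>
      x \<stileturn>\<^bsub>L\<^esub> (y \<oplus>\<^bsub>L\<^esub> z) = x \<stileturn>\<^bsub>L\<^esub> y \<oplus>\<^bsub>L\<^esub> x \<stileturn>\<^bsub>L\<^esub> z"
    and lprod_add_left: "\<lbrakk>x \<in> carrier L; y \<in> carrier L; z \<in> carrier L\<rbrakk> \<Longrightarrow>
      (y \<oplus>\<^bsub>L\<^esub> z) \<stileturn>\<^bsub>L\<^esub> x = y \<stileturn>\<^bsub>L\<^esub> x \<oplus>\<^bsub>L\<^esub> z \<stileturn>\<^bsub>L\<^esub> x"
    and lprod_smult_right: "\<lbrakk>a \<in> carrier F; x \<in> carrier L; y \<in> carrier L\<rbrakk> \<Longrightarrow>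
      x \<stileturn>\<^bsub>L\<^esub> (a \<odot>\<^bsub>L\<^esub> y) = a \<odot>\<^bsub>L\<^esub> (x \<stileturn>\<^bsub>L\<^esub> y)"
    and lprod_smult_left: "\<lbrakk>a \<in> carrier F; x \<in> carrier L; y \<in> carrier L\<rbrakk> \<Longrightarrow>
      (a \<odot>\<^bsub>L\<^esub> y) \<stileturn>\<^bsub>L\<^esub> x = a \<odot>\<^bsub>L\<^esub> (y \<stileturn>\<^bsub>L\<^esub> x)"
  using lprod_bilinear unfolding bilinear_maps_iff[OF vec_space_axioms] by (auto simp: PiE_def Pi_def)

lemma
  shows rprod_closed [simp, intro]:
      "\<lbrakk>x \<in> carrier L; y \<in> carrier L\<rbrakk> \<Longrightarrow> x \<turnstile>\<^bsub>L\<^esub> y \<in> carrier L"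
    and rprod_add_right: "\<lbrakk>x \<in> carrier L; y \<in> carrier L; z \<in> carrier L\<rbrakk> \<Longrightarrow>
      x \<turnstile>\<^bsub>L\<^esub> (y \<oplus>\<^bsub>L\<^esub> z) = x \<turnstile>\<^bsub>L\<^esub> y \<oplus>\<^bsub>L\<^esub> x \<turnstile>\<^bsub>L\<^esub> z"
    and rprod_add_left: "\<lbrakk>x \<in> carrier L; y \<in> carrier L; z \<in> carrier L\<rbrakk> \<Longrightarrow>
      (y \<oplus>\<^bsub>L\<^esub> z) \<turnstile>\<^bsub>L\<^esub> x = y \<turnstile>\<^bsub>L\<^esub> x \<oplus>\<^bsub>L\<^esub> z \<turnstile>\<^bsub>L\<^esub> x"
    and rprod_smult_right: "\<lbrakk>a \<in> carrier F; x \<in> carrier L; y \<in> carrier L\<rbrakk> \<Longrightarrow>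
      x \<turnstile>\<^bsub>L\<^esub> (a \<odot>\<^bsub>L\<^esub> y) = a \<odot>\<^bsub>L\<^esub> (x \<turnstile>\<^bsub>L\<^esub> y)"
    and rprod_smult_left: "\<lbrakk>a \<in> carrier F; x \<in> carrier L; y \<in> carrier L\<rbrakk> \<Longrightarrow>
      (a \<odot>\<^bsub>L\<^esub> y) \<turnstile>\<^bsub>L\<^esub> x = a \<odot>\<^bsub>L\<^esub> (y \<turnstile>\<^bsub>L\<^esub> x)"
  using rprod_bilinear unfolding bilinear_maps_iff[OF vec_space_axioms] by (auto simp: PiE_def Pi_def)

end

lemma diassociative_algebraI:
  assumes "vec_space F L"
    and l: "\<And>x y. \<lbrakk>x \<in> carrier L; y \<in> carrier L\<rbrakk> \<Longrightarrow> x \<stileturn>\<^bsub>L\<^esub> y \<in> carrier L"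
      "\<And>x y z. \<lbrakk>x \<in> carrier L; y \<in> carrier L; z \<in> carrier L\<rbrakk> \<Longrightarrow>
        x \<stileturn>\<^bsub>L\<^esub> (y \<oplus>\<^bsub>L\<^esub> z) = x \<stileturn>\<^bsub>L\<^esub> y \<oplus>\<^bsub>L\<^esub> x \<stileturn>\<^bsub>L\<^esub> z"
      "\<And>x y z. \<lbrakk>x \<in> carrier L; y \<in> carrier L; z \<in> carrier L\<rbrakk> \<Longrightarrow>
        (y \<oplus>\<^bsub>L\<^esub> z) \<stileturn>\<^bsub>L\<^esub> x = y \<stileturn>\<^bsub>L\<^esub> x \<oplus>\<^bsub>L\<^esub> z \<stileturn>\<^bsub>L\<^esub> x"
      "\<And>a x y. \<lbrakk>a \<in> carrier F; x \<in> carrier L; y \<in> carrier L\<rbrakk> \<Longrightarrow>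
        x \<stileturn>\<^bsub>L\<^esub> (a \<odot>\<^bsub>L\<^esub> y) = a \<odot>\<^bsub>L\<^esub> (x \<stileturn>\<^bsub>L\<^esub> y)"
      "\<And>a x y. \<lbrakk>a \<in> carrier F; x \<in> carrier L; y \<in> carrier L\<rbrakk> \<Longrightarrow>
        (a \<odot>\<^bsub>L\<^esub> y) \<stileturn>\<^bsub>L\<^esub> x = a \<odot>\<^bsub>L\<^esub> (y \<stileturn>\<^bsub>L\<^esub> x)"
    and r: "\<And>x y. \<lbrakk>x \<in> carrier L; y \<in> carrier L\<rbrakk> \<Longrightarrow> x \<turnstile>\<^bsub>L\<^esub> y \<in> carrier L"
      "\<And>x y z. \<lbrakk>x \<in> carrier L; y \<in> carrier L; z \<in> carrier L\<rbrakk> \<Longrightarrow>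
        x \<turnstile>\<^bsub>L\<^esub> (y \<oplus>\<^bsub>L\<^esub> z) = x \<turnstile>\<^bsub>L\<^esub> y \<oplus>\<^bsub>L\<^esub> x \<turnstile>\<^bsub>L\<^esub> z"
      "\<And>x y z. \<lbrakk>x \<in> carrier L; y \<in> carrier L; z \<in> carrier L\<rbrakk> \<Longrightarrow>
        (y \<oplus>\<^bsub>L\<^esub> z) \<turnstile>\<^bsub>L\<^esub> x = y \<turnstile>\<^bsub>L\<^esub> x \<oplus>\<^bsub>L\<^esub> z \<turnstile>\<^bsub>L\<^esub> x"
      "\<And>a x y. \<lbrakk>a \<in> carrier F; x \<in> carrier L; y \<in> carrier L\<rbrakk> \<Longrightarrow>
        x \<turnstile>\<^bsub>L\<^esub> (a \<odot>\<^bsub>L\<^esub> y) = a \<odot>\<^bsub>L\<^esub> (x \<turnstile>\<^bsub>L\<^esub> y)"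
      "\<And>a x y. \<lbrakk>a \<in> carrier F; x \<in> carrier L; y \<in> carrier L\<rbrakk> \<Longrightarrow>
        (a \<odot>\<^bsub>L\<^esub> y) \<turnstile>\<^bsub>L\<^esub> x = a \<odot>\<^bsub>L\<^esub> (y \<turnstile>\<^bsub>L\<^esub> x)"
    and "\<And>x y z. \<lbrakk>x \<in> carrier L; y \<in> carrier L; z \<in> carrier L\<rbrakk> \<Longrightarrow>
      (x \<stileturn>\<^bsub>L\<^esub> y) \<stileturn>\<^bsub>L\<^esub> z = x \<stileturn>\<^bsub>L\<^esub> (y \<stileturn>\<^bsub>L\<^esub> z)"
    and "\<And>x y z. \<lbrakk>x \<in> carrier L; y \<in> carrier L; z \<in> carrier L\<rbrakk> \<Longrightarrow>
      (x \<turnstile>\<^bsub>L\<^esub> y) \<turnstile>\<^bsub>L\<^esub> z = x \<turnstile>\<^bsub>L\<^esub> (y \<turnstile>\<^bsub>L\<^esub> z)"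
    and "\<And>x y z. \<lbrakk>x \<in> carrier L; y \<in> carrier L; z \<in> carrier L\<rbrakk> \<Longrightarrow>
      x \<stileturn>\<^bsub>L\<^esub> (y \<stileturn>\<^bsub>L\<^esub> z) = x \<stileturn>\<^bsub>L\<^esub> (y \<turnstile>\<^bsub>L\<^esub> z)"
    and "\<And>x y z. \<lbrakk>x \<in> carrier L; y \<in> carrier L; z \<in> carrier L\<rbrakk> \<Longrightarrow>
      (x \<turnstile>\<^bsub>L\<^esub> y) \<stileturn>\<^bsub>L\<^esub> z = x \<turnstile>\<^bsub>L\<^esub> (y \<stileturn>\<^bsub>L\<^esub> z)"
    and "\<And>x y z. \<lbrakk>x \<in> carrier L; y \<in> carrier L; z \<in> carrier L\<rbrakk> \<Longrightarrow>
      (x \<stileturn>\<^bsub>L\<^esub> y) \<turnstile>\<^bsub>L\<^esub> z = (x \<turnstile>\<^bsub>L\<^esub> y) \<turnstile>\<^bsub>L\<^esub> z"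
  shows "diassociative_algebra F L"
proof -
  interpret L: vec_space F L by fact
  have "(\<lambda>(x, y)\<in>carrier L \<times> carrier L. x \<stileturn>\<^bsub>L\<^esub> y) \<in> bilinear_maps F L L"
    unfolding bilinear_maps_iff[OF assms(1)] by (auto simp: l)
  moreover have "(\<lambda>(x, y)\<in>carrier L \<times> carrier L. x \<turnstile>\<^bsub>L\<^esub> y) \<in> bilinear_maps F L L"
    unfolding bilinear_maps_iff[OF assms(1)] by (auto simp: r)
  ultimately show ?thesis
    by (intro diassociative_algebra.intro diassociative_algebra_axioms.intro assms)
qed

context diassociative_algebra
begin

text \<open>Multiplication by a fixed element, restricted to the carrier, is a linear map, and
  linear maps respect subtraction.\<close>

lemma prod_minus:
  assumes "x \<in> carrier L" "y \<in> carrier L" "z \<in> carrier L"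
  shows "x \<stileturn>\<^bsub>L\<^esub> (y \<ominus>\<^bsub>L\<^esub> z) = x \<stileturn>\<^bsub>L\<^esub> y \<ominus>\<^bsub>L\<^esub> x \<stileturn>\<^bsub>L\<^esub> z"
    and "(y \<ominus>\<^bsub>L\<^esub> z) \<stileturn>\<^bsub>L\<^esub> x = y \<stileturn>\<^bsub>L\<^esub> x \<ominus>\<^bsub>L\<^esub> z \<stileturn>\<^bsub>L\<^esub> x"
    and "x \<turnstile>\<^bsub>L\<^esub> (y \<ominus>\<^bsub>L\<^esub> z) = x \<turnstile>\<^bsub>L\<^esub> y \<ominus>\<^bsub>L\<^esub> x \<turnstile>\<^bsub>L\<^esub> z"
    and "(y \<ominus>\<^bsub>L\<^esub> z) \<turnstile>\<^bsub>L\<^esub> x = y \<turnstile>\<^bsub>L\<^esub> x \<ominus>\<^bsub>L\<^esub> z \<turnstile>\<^bsub>L\<^esub> x"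
proof -
  have minus: "f (y \<ominus>\<^bsub>L\<^esub> z) = f y \<ominus>\<^bsub>L\<^esub> f z" if "restrict f (carrier L) \<in> linear_maps F L L" for f
    using linear_map.map_minus[OF linear_mapI[OF vec_space_axioms vec_space_axioms that] assms(2,3)]
    by (simp add: assms M.minus_closed)
  show "x \<stileturn>\<^bsub>L\<^esub> (y \<ominus>\<^bsub>L\<^esub> z) = x \<stileturn>\<^bsub>L\<^esub> y \<ominus>\<^bsub>L\<^esub> x \<stileturn>\<^bsub>L\<^esub> z"
    by (rule minus, rule linear_mapsI) (auto simp: assms lprod_add_right lprod_smult_right)
  show "(y \<ominus>\<^bsub>L\<^esub> z) \<stileturn>\<^bsub>L\<^esub> x = y \<stileturn>\<^bsub>L\<^esub> x \<ominus>\<^bsub>L\<^esub> z \<stileturn>\<^bsub>L\<^esub> x"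
    by (rule minus, rule linear_mapsI) (auto simp: assms lprod_add_left lprod_smult_left)
  show "x \<turnstile>\<^bsub>L\<^esub> (y \<ominus>\<^bsub>L\<^esub> z) = x \<turnstile>\<^bsub>L\<^esub> y \<ominus>\<^bsub>L\<^esub> x \<turnstile>\<^bsub>L\<^esub> z"
    by (rule minus, rule linear_mapsI) (auto simp: assms rprod_add_right rprod_smult_right)
  show "(y \<ominus>\<^bsub>L\<^esub> z) \<turnstile>\<^bsub>L\<^esub> x = y \<turnstile>\<^bsub>L\<^esub> x \<ominus>\<^bsub>L\<^esub> z \<turnstile>\<^bsub>L\<^esub> x"
    by (rule minus, rule linear_mapsI) (auto simp: assms rprod_add_left rprod_smult_left)
qed

end

lemma FactDialgebra_simps:
  shows "carrier (FactDialgebra L H) = carrier (FactModule L H)"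
    and "zero (FactDialgebra L H) = zero (FactModule L H)"
    and "add (FactDialgebra L H) = add (FactModule L H)"
    and "smult (FactDialgebra L H) = smult (FactModule L H)"
  by (simp_all add: FactDialgebra_def module.extend_def)

locale quotient_dialgebra =
  diassociative_algebra F L + dialgebra_ideal H F L for F (structure) and L (structure) and H
begin

sublocale quotient_space F L H ..

lemma lprod_quotient:
  assumes x: "x \<in> carrier L" and y: "y \<in> carrier L"
  shows "(H +>\<^bsub>L\<^esub> x) \<stileturn>\<^bsub>FactDialgebra L H\<^esub> (H +>\<^bsub>L\<^esub> y) = H +>\<^bsub>L\<^esub> (x \<stileturn>\<^bsub>L\<^esub> y)"
proof -
  \<comment> \<open>The double union collapses one factor at a time. Replacing y by y' changes the
    product by x' \<stileturn> (y' - y), which lies in the ideal; the outer union is treated in the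
    same way.\<close>
  have inner: "(\<Union>y'\<in>H +>\<^bsub>L\<^esub> y. H +>\<^bsub>L\<^esub> (x' \<stileturn>\<^bsub>L\<^esub> y')) = H +>\<^bsub>L\<^esub> (x' \<stileturn>\<^bsub>L\<^esub> y)"
    if "x' \<in> carrier L" for x'
    by (rule UN_coset[OF y], subst coset_eq_iff)
      (use that y in \<open>auto simp: prod_minus[symmetric] ideal_closed\<close>)
  have "(\<Union>x'\<in>H +>\<^bsub>L\<^esub> x. \<Union>y'\<in>H +>\<^bsub>L\<^esub> y. H +>\<^bsub>L\<^esub> (x' \<stileturn>\<^bsub>L\<^esub> y')) =
      (\<Union>x'\<in>H +>\<^bsub>L\<^esub> x. H +>\<^bsub>L\<^esub> (x' \<stileturn>\<^bsub>L\<^esub> y))"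
    by (intro SUP_cong refl inner) (auto simp: mem_coset_iff x)
  also have "\<dots> = H +>\<^bsub>L\<^esub> (x \<stileturn>\<^bsub>L\<^esub> y)"
    by (rule UN_coset[OF x], subst coset_eq_iff)
      (use x y in \<open>auto simp: prod_minus[symmetric] ideal_closed\<close>)
  finally show ?thesis
    by (simp add: FactDialgebra_def module.extend_def dialgebra.fields_def)
qed

lemma rprod_quotient:
  assumes x: "x \<in> carrier L" and y: "y \<in> carrier L"
  shows "(H +>\<^bsub>L\<^esub> x) \<turnstile>\<^bsub>FactDialgebra L H\<^esub> (H +>\<^bsub>L\<^esub> y) = H +>\<^bsub>L\<^esub> (x \<turnstile>\<^bsub>L\<^esub> y)"
proof -
  have inner: "(\<Union>y'\<in>H +>\<^bsub>L\<^esub> y. H +>\<^bsub>L\<^esub> (x' \<turnstile>\<^bsub>L\<^esub> y')) = H +>\<^bsub>L\<^esub> (x' \<turnstile>\<^bsub>L\<^esub> y)"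
    if "x' \<in> carrier L" for x'
    by (rule UN_coset[OF y], subst coset_eq_iff)
      (use that y in \<open>auto simp: prod_minus[symmetric] ideal_closed\<close>)
  have "(\<Union>x'\<in>H +>\<^bsub>L\<^esub> x. \<Union>y'\<in>H +>\<^bsub>L\<^esub> y. H +>\<^bsub>L\<^esub> (x' \<turnstile>\<^bsub>L\<^esub> y')) =
      (\<Union>x'\<in>H +>\<^bsub>L\<^esub> x. H +>\<^bsub>L\<^esub> (x' \<turnstile>\<^bsub>L\<^esub> y))"
    by (intro SUP_cong refl inner) (auto simp: mem_coset_iff x)
  also have "\<dots> = H +>\<^bsub>L\<^esub> (x \<turnstile>\<^bsub>L\<^esub> y)"
    by (rule UN_coset[OF x], subst coset_eq_iff)
      (use x y in \<open>auto simp: prod_minus[symmetric] ideal_closed\<close>)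
  finally show ?thesis
    by (simp add: FactDialgebra_def module.extend_def dialgebra.fields_def)
qed

lemma diassociative_quotient: "diassociative_algebra F (FactDialgebra L H)"
proof (rule diassociative_algebraI)
  show "vec_space F (FactDialgebra L H)"
    by (rule vec_space_cong[OF quotient_vec_space]) (simp_all add: FactDialgebra_simps)
qed (auto simp: FactDialgebra_simps carrier_quotient add_quotient smult_quotient lprod_quotient rprod_quotient
    lprod_add_right lprod_add_left lprod_smult_right lprod_smult_left
    rprod_add_right rprod_add_left rprod_smult_right rprod_smult_left
    lprod_assoc rprod_assoc left_bar inner_assoc right_bar)

lemma diassociative_ideal: "diassociative_algebra F (L\<lparr>carrier := H\<rparr>)"
proof (rule diassociative_algebraI)
  show "vec_space F (L\<lparr>carrier := H\<rparr>)"
    by (intro submodule_vec_space submodule_axioms)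
qed (auto simp: ideal_closed
    lprod_add_right lprod_add_left lprod_smult_right lprod_smult_left
    rprod_add_right rprod_add_left rprod_smult_right rprod_smult_left
    lprod_assoc rprod_assoc left_bar inner_assoc right_bar)

end

section \<open>Homomorphisms, cocycles and coboundaries\<close>

text \<open>Naming the map from \<epsilon> to its coboundary exhibits \<open>B2\<close> as an image,
  so that it is a subspace once this map is known to be linear.\<close>

definition coboundary :: 
  "('f, 'b, 'm) dialgebra_scheme \<Rightarrow> ('f, 'a) module \<Rightarrow> ('b \<Rightarrow> 'a) \<Rightarrow> ('b, 'a) cochain2"
  where "coboundary B A \<epsilon> =
    (\<lambda>(i, j)\<in>carrier B \<times> carrier B. \<ominus>\<^bsub>A\<^esub> \<epsilon> (i \<stileturn>\<^bsub>B\<^esub> j),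
     \<lambda>(i, j)\<in>carrier B \<times> carrier B. \<ominus>\<^bsub>A\<^esub> \<epsilon> (i \<turnstile>\<^bsub>B\<^esub> j))"

text \<open>The algebra \<open>B\<close> is kept abstract because \<open>Hom\<close> is needed for
  L, for its quotient and for the ideal, and the cohomology for the first two of these.\<close>

locale dialgebra_coefficients = B: diassociative_algebra F B + A: vec_space F A
  for F (structure) and B :: "('f, 'b, 'm) dialgebra_scheme" (structure)
    and A :: "('f, 'a) module" (structure)
begin

text \<open>All products in the target are zero, so multiplicativity amounts to vanishing on
  products, a condition that passes to sums and multiples.\<close>

lemma dialgebra_hom_iff: "f \<in> dialgebra_hom F B (zero_products A) \<longleftrightarrow>
    f \<in> linear_maps F B A \<and> (\<forall>x\<in>carrier B. \<forall>y\<in>carrier B.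
      f (x \<stileturn>\<^bsub>B\<^esub> y) = \<zero>\<^bsub>A\<^esub> \<and> f (x \<turnstile>\<^bsub>B\<^esub> y) = \<zero>\<^bsub>A\<^esub>)"
  by (simp add: dialgebra_hom_def linear_maps_def zero_products_def module.extend_def
      dialgebra.fields_def)

lemma Hom_vec_space: "vec_space F (Hom F B A)"
proof -
  interpret S: vec_space F "fun_space (carrier B) A" by (rule A.fun_space_vec_space)
  interpret lin: submodule "linear_maps F B A" F "fun_space (carrier B) A"
    by (intro linear_maps_submodule B.vec_space_axioms A.vec_space_axioms)
  have "submodule (dialgebra_hom F B (zero_products A)) F (fun_space (carrier B) A)"
  proof (rule S.submoduleI')
    show "dialgebra_hom F B (zero_products A) \<subseteq> carrier (fun_space (carrier B) A)"
      using lin.subset by (auto simp: dialgebra_hom_iff)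
    show "\<zero>\<^bsub>fun_space (carrier B) A\<^esub> \<in> dialgebra_hom F B (zero_products A)"
      using lin.one_closed by (simp add: dialgebra_hom_iff fun_space_def)
  next
    fix f g assume "f \<in> dialgebra_hom F B (zero_products A)" "g \<in> dialgebra_hom F B (zero_products A)"
    then show "f \<oplus>\<^bsub>fun_space (carrier B) A\<^esub> g \<in> dialgebra_hom F B (zero_products A)"
      using lin.m_closed[of f g] by (simp add: dialgebra_hom_iff fun_space_def)
  next
    fix a f assume "a \<in> carrier F" "f \<in> dialgebra_hom F B (zero_products A)"
    then show "a \<odot>\<^bsub>fun_space (carrier B) A\<^esub> f \<in> dialgebra_hom F B (zero_products A)"
      using lin.smult_closed[of a f] by (simp add: dialgebra_hom_iff fun_space_def)
  qed
  from S.submodule_vec_space[OF this] show ?thesis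
    by (rule vec_space_cong) (simp_all add: Hom_def fun_space_def)
qed

text \<open>The five defining equations reoriented for rewriting: every side with a product in the
  second argument is sent to one with the product in the first, so no expression has two competing
  rules.\<close>

lemma cocycles2_iff: "(f, g) \<in> cocycles2 F B A \<longleftrightarrow>
    f \<in> bilinear_maps F B A \<and> g \<in> bilinear_maps F B A \<and>
    (\<forall>i\<in>carrier B. \<forall>j\<in>carrier B. \<forall>k\<in>carrier B.
      f (i, j \<stileturn>\<^bsub>B\<^esub> k) = f (i \<stileturn>\<^bsub>B\<^esub> j, k) \<and> f (i, j \<turnstile>\<^bsub>B\<^esub> k) = f (i \<stileturn>\<^bsub>B\<^esub> j, k) \<and>
      g (i, j \<stileturn>\<^bsub>B\<^esub> k) = f (i \<turnstile>\<^bsub>B\<^esub> j, k) \<and>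
      g (i \<stileturn>\<^bsub>B\<^esub> j, k) = g (i \<turnstile>\<^bsub>B\<^esub> j, k) \<and> g (i, j \<turnstile>\<^bsub>B\<^esub> k) = g (i \<turnstile>\<^bsub>B\<^esub> j, k))"
  unfolding cocycles2_def mem_Collect_eq prod.case mem_Times_iff fst_conv snd_conv conj_assoc
  by (intro conj_cong[OF refl] ball_cong[OF refl]) metis

abbreviation cochains where
  "cochains \<equiv> prod_space (fun_space (carrier B \<times> carrier B) A) (fun_space (carrier B \<times> carrier B) A)"

lemma cochains_vec_space: "vec_space F cochains"
  by (intro prod_space_vec_space A.fun_space_vec_space)

lemma cocycles2_submodule: "submodule (cocycles2 F B A) F cochains"
proof -
  interpret S: vec_space F cochains by (rule cochains_vec_space)
  interpret bil: submodule "bilinear_maps F B A" F "fun_space (carrier B \<times> carrier B) A"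
    by (intro bilinear_maps_submodule B.vec_space_axioms A.vec_space_axioms)
  show ?thesis
  proof (rule S.submoduleI')
    show "cocycles2 F B A \<subseteq> carrier cochains"
      using bil.subset by (auto simp: cocycles2_iff prod_space_def)
    show "\<zero>\<^bsub>cochains\<^esub> \<in> cocycles2 F B A"
      using bil.one_closed by (simp add: cocycles2_iff prod_space_def fun_space_def)
  next
    fix p q assume "p \<in> cocycles2 F B A" "q \<in> cocycles2 F B A"
    moreover obtain f g f' g' where "p = (f, g)" "q = (f', g')" by fastforce
    ultimately show "p \<oplus>\<^bsub>cochains\<^esub> q \<in> cocycles2 F B A"
      using bil.m_closed[of f f'] bil.m_closed[of g g']
      by (simp add: cocycles2_iff prod_space_def fun_space_def)
  next
    fix a p assume "a \<in> carrier F" "p \<in> cocycles2 F B A"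
    moreover obtain f g where "p = (f, g)" by fastforce
    ultimately show "a \<odot>\<^bsub>cochains\<^esub> p \<in> cocycles2 F B A"
      using bil.smult_closed[of a f] bil.smult_closed[of a g]
      by (simp add: cocycles2_iff prod_space_def fun_space_def)
  qed
qed

lemma Z2_eq: "Z2 F B A = cochains\<lparr>carrier := cocycles2 F B A\<rparr>"
  by (simp add: Z2_def prod_space_def fun_space_def fun_eq_iff split: prod.split)

lemma Z2_vec_space: "vec_space F (Z2 F B A)"
  unfolding Z2_eq by (intro vec_space.submodule_vec_space cochains_vec_space cocycles2_submodule)

lemma carrier_Z2 [simp]: "carrier (Z2 F B A) = cocycles2 F B A"
  by (simp add: Z2_def)

lemma B2_eq: "B2 F B A = coboundary B A ` linear_maps F B A"
  by (auto simp: B2_def coboundary_def)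

text \<open>Each cocycle identity is -\<epsilon> applied to one of the axioms of \<open>B\<close>,
  and bilinearity is inherited from the products.\<close>

lemma coboundary_cocycle:
  assumes "\<epsilon> \<in> linear_maps F B A"
  shows "coboundary B A \<epsilon> \<in> cocycles2 F B A"
proof -
  interpret e: linear_map F B A \<epsilon> 
    using assms by (intro linear_mapI B.vec_space_axioms A.vec_space_axioms)
  show ?thesis
    unfolding coboundary_def cocycles2_iff bilinear_maps_iff[OF B.vec_space_axioms]
    by (auto simp: B.lprod_add_right B.lprod_add_left B.lprod_smult_right B.lprod_smult_left
      B.rprod_add_right B.rprod_add_left B.rprod_smult_right B.rprod_smult_left
      B.lprod_assoc B.rprod_assoc B.left_bar[symmetric] B.inner_assoc B.right_bar
      e.map_add e.map_smult A.M.minus_add A.smult_r_minus)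
qed

text \<open>The coboundary depends linearly on \<epsilon>, so \<open>B2\<close> is the image of a
  linear map from the space of linear maps into \<open>Z2\<close>. The map is restricted because
  members of \<open>linear_maps\<close> are extensional.\<close>

lemma B2_submodule: "submodule (B2 F B A) F (Z2 F B A)"
proof -
  let ?E = "(fun_space (carrier B) A)\<lparr>carrier := linear_maps F B A\<rparr>"
  interpret lin: submodule "linear_maps F B A" F "fun_space (carrier B) A"
    by (intro linear_maps_submodule B.vec_space_axioms A.vec_space_axioms)
  have "restrict (coboundary B A) (linear_maps F B A) \<in> linear_maps F ?E (Z2 F B A)"
  proof (rule linear_mapsI)
    fix f g assume "f \<in> carrier ?E" "g \<in> carrier ?E"
    moreover from this interpret f: linear_map F B A f + g: linear_map F B A g
      by (auto intro: linear_mapI B.vec_space_axioms A.vec_space_axioms)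
    have "f \<oplus>\<^bsub>?E\<^esub> g \<in> linear_maps F B A"
      using lin.m_closed[of f g] f.linear g.linear by simp
    ultimately show "restrict (coboundary B A) (linear_maps F B A) (f \<oplus>\<^bsub>?E\<^esub> g) =
        restrict (coboundary B A) (linear_maps F B A) f \<oplus>\<^bsub>Z2 F B A\<^esub> restrict (coboundary B A) (linear_maps F B A) g"
      by (auto simp: coboundary_def Z2_def fun_space_def fun_eq_iff A.M.minus_add)
  next
    fix a f assume a: "a \<in> carrier F" and "f \<in> carrier ?E"
    moreover from this interpret f: linear_map F B A f
      by (auto intro: linear_mapI B.vec_space_axioms A.vec_space_axioms)
    have "a \<odot>\<^bsub>?E\<^esub> f \<in> linear_maps F B A"
      using lin.smult_closed[of a f] f.linear a by simp
    ultimately show "restrict (coboundary B A) (linear_maps F B A) (a \<odot>\<^bsub>?E\<^esub> f) =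
        a \<odot>\<^bsub>Z2 F B A\<^esub> restrict (coboundary B A) (linear_maps F B A) f"
      by (auto simp: coboundary_def Z2_def fun_space_def fun_eq_iff A.smult_r_minus)
  qed (auto simp: coboundary_cocycle)
  then interpret d: linear_map F ?E "Z2 F B A" "restrict (coboundary B A) (linear_maps F B A)"
    by (intro linear_mapI Z2_vec_space vec_space.submodule_vec_space A.fun_space_vec_space
        linear_maps_submodule B.vec_space_axioms A.vec_space_axioms)
  show ?thesis
    using d.submodule_image by (simp add: B2_eq)
qed

sublocale Z2: quotient_space F "Z2 F B A" "B2 F B A"
  by (intro quotient_space.intro Z2_vec_space B2_submodule)

end

section \<open>Central extensions\<close>

locale central_extension = quotient_dialgebra F L H + A: vec_space F A
  for F (structure) and L :: "('f, 'l, 'm) dialgebra_scheme" (structure) and H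
    and A :: "('f, 'a) module" (structure) +
  fixes \<mu>
  assumes central: "H \<subseteq> center L" and is_section: "is_section F L H \<mu>"
begin

abbreviation "Q \<equiv> FactDialgebra L H"
abbreviation "\<beta> \<equiv> quot_map L H"
abbreviation "K \<equiv> L\<lparr>carrier := H\<rparr>"

sublocale CL: dialgebra_coefficients F L A ..

sublocale CQ: dialgebra_coefficients F Q A
  by (intro dialgebra_coefficients.intro diassociative_quotient A.vec_space_axioms)

sublocale CK: dialgebra_coefficients F K A
  by (intro dialgebra_coefficients.intro diassociative_ideal A.vec_space_axioms)

sublocale \<beta>: linear_map F L Q \<beta>
proof (intro linear_mapI vec_space_axioms CQ.B.vec_space_axioms)
  show "\<beta> \<in> linear_maps F L Q"
    using coset_linear by (simp add: quot_map_def linear_maps_def FactDialgebra_simps)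
qed

sublocale \<mu>: linear_map F Q L \<mu>
  using is_section by (intro linear_mapI vec_space_axioms CQ.B.vec_space_axioms) (simp add: is_section_def)

section \<open>Products modulo a central ideal\<close>

lemma \<beta>_\<mu> [simp]: "X \<in> carrier Q \<Longrightarrow> \<beta> (\<mu> X) = X"
  using is_section by (simp add: is_section_def)

lemma \<beta>_prod:
  assumes "x \<in> carrier L" "y \<in> carrier L"
  shows "\<beta> (x \<stileturn>\<^bsub>L\<^esub> y) = \<beta> x \<stileturn>\<^bsub>Q\<^esub> \<beta> y" "\<beta> (x \<turnstile>\<^bsub>L\<^esub> y) = \<beta> x \<turnstile>\<^bsub>Q\<^esub> \<beta> y"
  using assms by (simp_all add: quot_map_def lprod_quotient rprod_quotient)

lemma \<beta>_eq_iff: "\<lbrakk>x \<in> carrier L; y \<in> carrier L\<rbrakk> \<Longrightarrow> \<beta> x = \<beta> y \<longleftrightarrow> x \<ominus>\<^bsub>L\<^esub> y \<in> H"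
  by (simp add: quot_map_def coset_eq_iff)

lemma \<beta>_ideal: "h \<in> H \<Longrightarrow> \<beta> h = \<zero>\<^bsub>Q\<^esub>"
  by (simp add: quot_map_def FactDialgebra_simps zero_quotient a_rcos_const)

text \<open>Both elements have the same image under \<beta>, because \<mu> is a section.\<close>

lemma diff_in_ideal: "x \<in> carrier L \<Longrightarrow> x \<ominus>\<^bsub>L\<^esub> \<mu> (\<beta> x) \<in> H"
  by (subst \<beta>_eq_iff[symmetric]) simp_all

lemma prod_ideal:
  assumes "h \<in> H" "x \<in> carrier L"
  shows "h \<stileturn>\<^bsub>L\<^esub> x = \<zero>\<^bsub>L\<^esub>" "x \<stileturn>\<^bsub>L\<^esub> h = \<zero>\<^bsub>L\<^esub>" "h \<turnstile>\<^bsub>L\<^esub> x = \<zero>\<^bsub>L\<^esub>" "x \<turnstile>\<^bsub>L\<^esub> h = \<zero>\<^bsub>L\<^esub>"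
  using assms central by (auto simp: center_def)

lemma eq_of_minus_zero: "\<lbrakk>x \<in> carrier L; y \<in> carrier L; x \<ominus>\<^bsub>L\<^esub> y = \<zero>\<^bsub>L\<^esub>\<rbrakk> \<Longrightarrow> x = y"
  using M.add.inv_equality M.minus_equality M.minus_minus by (metis M.a_inv_closed a_minus_def)

text \<open>The factors are exchanged one at a time. Each exchange changes the product by a product
  with a difference of representatives, which lies in H and hence in the center, so the change is
  zero.\<close>

lemma prod_cong_coset:
  assumes "x \<in> carrier L" "x' \<in> carrier L" "y \<in> carrier L" "y' \<in> carrier L"
    and "\<beta> x = \<beta> x'" "\<beta> y = \<beta> y'"
  shows "x \<stileturn>\<^bsub>L\<^esub> y = x' \<stileturn>\<^bsub>L\<^esub> y'" "x \<turnstile>\<^bsub>L\<^esub> y = x' \<turnstile>\<^bsub>L\<^esub> y'"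
proof -
  have h: "x \<ominus>\<^bsub>L\<^esub> x' \<in> H" "y \<ominus>\<^bsub>L\<^esub> y' \<in> H"
    using assms \<beta>_eq_iff by simp_all
  have "x \<stileturn>\<^bsub>L\<^esub> y = x' \<stileturn>\<^bsub>L\<^esub> y"
    by (rule eq_of_minus_zero) (simp_all add: prod_minus[symmetric] assms prod_ideal h)
  also have "\<dots> = x' \<stileturn>\<^bsub>L\<^esub> y'"
    by (rule eq_of_minus_zero) (simp_all add: prod_minus[symmetric] assms prod_ideal h)
  finally show "x \<stileturn>\<^bsub>L\<^esub> y = x' \<stileturn>\<^bsub>L\<^esub> y'" .
  have "x \<turnstile>\<^bsub>L\<^esub> y = x' \<turnstile>\<^bsub>L\<^esub> y"
    by (rule eq_of_minus_zero) (simp_all add: prod_minus[symmetric] assms prod_ideal h)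
  also have "\<dots> = x' \<turnstile>\<^bsub>L\<^esub> y'"
    by (rule eq_of_minus_zero) (simp_all add: prod_minus[symmetric] assms prod_ideal h)
  finally show "x \<turnstile>\<^bsub>L\<^esub> y = x' \<turnstile>\<^bsub>L\<^esub> y'" .
qed

lemma prod_\<mu>_\<beta>:
  assumes "x \<in> carrier L" "y \<in> carrier L"
  shows "\<mu> (\<beta> x) \<stileturn>\<^bsub>L\<^esub> \<mu> (\<beta> y) = x \<stileturn>\<^bsub>L\<^esub> y" "\<mu> (\<beta> x) \<turnstile>\<^bsub>L\<^esub> \<mu> (\<beta> y) = x \<turnstile>\<^bsub>L\<^esub> y"
  by (intro prod_cong_coset; simp add: assms)+

text \<open>The lift of a product and the product of the lifts lie in the same coset, so they are
  interchangeable as factors even though they need not be equal.\<close>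

lemma prod_\<mu>:
  assumes "X \<in> carrier Q" "Y \<in> carrier Q" "Z \<in> carrier Q"
  shows "\<mu> X \<stileturn>\<^bsub>L\<^esub> \<mu> (Y \<stileturn>\<^bsub>Q\<^esub> Z) = \<mu> X \<stileturn>\<^bsub>L\<^esub> (\<mu> Y \<stileturn>\<^bsub>L\<^esub> \<mu> Z)"
    and "\<mu> X \<stileturn>\<^bsub>L\<^esub> \<mu> (Y \<turnstile>\<^bsub>Q\<^esub> Z) = \<mu> X \<stileturn>\<^bsub>L\<^esub> (\<mu> Y \<turnstile>\<^bsub>L\<^esub> \<mu> Z)"
    and "\<mu> X \<turnstile>\<^bsub>L\<^esub> \<mu> (Y \<stileturn>\<^bsub>Q\<^esub> Z) = \<mu> X \<turnstile>\<^bsub>L\<^esub> (\<mu> Y \<stileturn>\<^bsub>L\<^esub> \<mu> Z)"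
    and "\<mu> X \<turnstile>\<^bsub>L\<^esub> \<mu> (Y \<turnstile>\<^bsub>Q\<^esub> Z) = \<mu> X \<turnstile>\<^bsub>L\<^esub> (\<mu> Y \<turnstile>\<^bsub>L\<^esub> \<mu> Z)"
    and "\<mu> (X \<stileturn>\<^bsub>Q\<^esub> Y) \<stileturn>\<^bsub>L\<^esub> \<mu> Z = (\<mu> X \<stileturn>\<^bsub>L\<^esub> \<mu> Y) \<stileturn>\<^bsub>L\<^esub> \<mu> Z"
    and "\<mu> (X \<turnstile>\<^bsub>Q\<^esub> Y) \<stileturn>\<^bsub>L\<^esub> \<mu> Z = (\<mu> X \<turnstile>\<^bsub>L\<^esub> \<mu> Y) \<stileturn>\<^bsub>L\<^esub> \<mu> Z"
    and "\<mu> (X \<stileturn>\<^bsub>Q\<^esub> Y) \<turnstile>\<^bsub>L\<^esub> \<mu> Z = (\<mu> X \<stileturn>\<^bsub>L\<^esub> \<mu> Y) \<turnstile>\<^bsub>L\<^esub> \<mu> Z"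
    and "\<mu> (X \<turnstile>\<^bsub>Q\<^esub> Y) \<turnstile>\<^bsub>L\<^esub> \<mu> Z = (\<mu> X \<turnstile>\<^bsub>L\<^esub> \<mu> Y) \<turnstile>\<^bsub>L\<^esub> \<mu> Z"
  using assms CQ.B.lprod_closed CQ.B.rprod_closed \<mu>.map_closed
  by (intro prod_cong_coset; simp add: \<beta>_prod)+

section \<open>Cocycles on the quotient obtained from linear maps on L\<close>

definition section_cocycle :: "('l \<Rightarrow> 'a) \<Rightarrow> ('l set, 'a) cochain2" where
  "section_cocycle p =
    (\<lambda>(X, Y)\<in>carrier Q \<times> carrier Q. p (\<mu> X \<stileturn>\<^bsub>L\<^esub> \<mu> Y),
     \<lambda>(X, Y)\<in>carrier Q \<times> carrier Q. p (\<mu> X \<turnstile>\<^bsub>L\<^esub> \<mu> Y))"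

text \<open>After \<open>prod_\<mu>\<close> has replaced lifts of products by products of lifts,
  each cocycle identity is \<open>p\<close> applied to an axiom of L. Bilinearity uses that \<mu> is
  linear.\<close>

lemma section_cocycle_closed:
  assumes "p \<in> linear_maps F L A"
  shows "section_cocycle p \<in> cocycles2 F Q A"
proof -
  interpret p: linear_map F L A p
    using assms by (intro linear_mapI vec_space_axioms A.vec_space_axioms)
  show ?thesis
    unfolding section_cocycle_def CQ.cocycles2_iff bilinear_maps_iff[OF CQ.B.vec_space_axioms]
    by (auto simp: \<mu>.map_add \<mu>.map_smult p.map_add p.map_smult prod_\<mu>
      lprod_add_right lprod_add_left lprod_smult_right lprod_smult_left
      rprod_add_right rprod_add_left rprod_smult_right rprod_smult_left
      lprod_assoc rprod_assoc left_bar[symmetric] inner_assoc right_bar)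
qed

section \<open>Inflation of cocycles, the map that induces \<open>Inf2\<close> on classes\<close>

definition inflate :: "('l set, 'a) cochain2 \<Rightarrow> ('l, 'a) cochain2" where
  "inflate = (\<lambda>(f, g).
    (\<lambda>(x, y)\<in>carrier L \<times> carrier L. f (\<beta> x, \<beta> y), \<lambda>(x, y)\<in>carrier L \<times> carrier L. g (\<beta> x, \<beta> y)))"

lemma inflate_closed:
  assumes "\<phi> \<in> cocycles2 F Q A"
  shows "inflate \<phi> \<in> cocycles2 F L A"
proof -
  obtain f g where \<phi>: "\<phi> = (f, g)" by fastforce
  show ?thesis
    using assms
    unfolding \<phi> inflate_def prod.case CQ.cocycles2_iff CL.cocycles2_iff bilinear_maps_iff[OF CQ.B.vec_space_axioms]
      bilinear_maps_iff[OF vec_space_axioms]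
    by (simp add: \<beta>.map_add \<beta>.map_smult \<beta>_prod PiE_def Pi_def)
qed

lemma inflate_linear: "restrict inflate (cocycles2 F Q A) \<in> linear_maps F (Z2 F Q A) (Z2 F L A)"
proof (rule linear_mapsI)
  fix \<phi> \<psi> assume "\<phi> \<in> carrier (Z2 F Q A)" "\<psi> \<in> carrier (Z2 F Q A)"
  moreover from this have "\<phi> \<oplus>\<^bsub>Z2 F Q A\<^esub> \<psi> \<in> carrier (Z2 F Q A)"
    by (rule CQ.Z2.M.a_closed)
  moreover obtain f g f' g' where "\<phi> = (f, g)" "\<psi> = (f', g')" by fastforce
  ultimately show "restrict inflate (cocycles2 F Q A) (\<phi> \<oplus>\<^bsub>Z2 F Q A\<^esub> \<psi>) =
      restrict inflate (cocycles2 F Q A) \<phi> \<oplus>\<^bsub>Z2 F L A\<^esub> restrict inflate (cocycles2 F Q A) \<psi>"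
    by (auto simp: inflate_def Z2_def fun_eq_iff)
next
  fix a \<phi> assume "a \<in> carrier F" "\<phi> \<in> carrier (Z2 F Q A)"
  moreover from this have "a \<odot>\<^bsub>Z2 F Q A\<^esub> \<phi> \<in> carrier (Z2 F Q A)"
    by (rule module.smult_closed[OF CQ.Z2.module_axioms])
  moreover obtain f g where "\<phi> = (f, g)" by fastforce
  ultimately show "restrict inflate (cocycles2 F Q A) (a \<odot>\<^bsub>Z2 F Q A\<^esub> \<phi>) =
      a \<odot>\<^bsub>Z2 F L A\<^esub> restrict inflate (cocycles2 F Q A) \<phi>"
    by (auto simp: inflate_def Z2_def fun_eq_iff)
qed (auto simp: inflate_closed)

text \<open>Multiplicativity of \<beta> turns \<epsilon> of a product of cosets into \<epsilon> o
  \<beta> of a product in L. Consequently inflation sends coboundaries to coboundaries and descends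
  to classes.\<close>

lemma inflate_coboundary:
  "inflate (coboundary Q A \<epsilon>) = coboundary L A (compose (carrier L) \<epsilon> \<beta>)"
proof -
  show ?thesis
    by (auto simp: inflate_def coboundary_def compose_def \<beta>_prod fun_eq_iff)
qed

lemma inflate_B2: "inflate ` B2 F Q A \<subseteq> B2 F L A"
proof (rule image_subsetI)
  fix \<phi> assume "\<phi> \<in> B2 F Q A"
  then obtain \<epsilon> where "\<epsilon> \<in> linear_maps F Q A" "\<phi> = coboundary Q A \<epsilon>"
    unfolding CQ.B2_eq by (rule imageE)
  then show "inflate \<phi> \<in> B2 F L A"
    using linear_maps_compose[OF vec_space_axioms \<beta>.linear, of \<epsilon> A] by (simp add: CL.B2_eq inflate_coboundary imageI)
qed

text \<open>By centrality the product of \<mu> (\<beta> x) and \<mu> (\<beta> y) is the product of x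
  and y, so the inflated cocycle is \<open>p\<close> evaluated at products of L. The negation
  offsets the sign in \<open>coboundary\<close>.\<close>

lemma inflate_section_cocycle:
  "inflate (section_cocycle p) = coboundary L A (\<lambda>x\<in>carrier L. \<ominus>\<^bsub>A\<^esub> p x)"
  if "p \<in> linear_maps F L A"
proof -
  interpret p: linear_map F L A p
    using that by (intro linear_mapI vec_space_axioms A.vec_space_axioms)
  show ?thesis
    by (auto simp: inflate_def coboundary_def section_cocycle_def prod_\<mu>_\<beta> fun_eq_iff)
qed

section \<open>The three spaces of homomorphisms, and extending maps from the ideal to L\<close>

lemma linear_map_L: "p \<in> linear_maps F L A \<Longrightarrow> linear_map F L A p"
  and linear_map_K: "\<chi> \<in> linear_maps F K A \<Longrightarrow> linear_map F K A \<chi>"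
  and linear_map_Q: "\<epsilon> \<in> linear_maps F Q A \<Longrightarrow> linear_map F Q A \<epsilon>"
  by (intro linear_mapI vec_space_axioms A.vec_space_axioms CQ.B.vec_space_axioms
      CK.B.vec_space_axioms; assumption)+

lemma linear_map_ideal:
  assumes "\<chi> \<in> linear_maps F K A"
  shows "h \<in> H \<Longrightarrow> \<chi> h \<in> carrier A" "\<lbrakk>h \<in> H; h' \<in> H\<rbrakk> \<Longrightarrow> \<chi> (h \<oplus>\<^bsub>L\<^esub> h') = \<chi> h \<oplus>\<^bsub>A\<^esub> \<chi> h'"
    "\<lbrakk>a \<in> carrier F; h \<in> H\<rbrakk> \<Longrightarrow> \<chi> (a \<odot>\<^bsub>L\<^esub> h) = a \<odot>\<^bsub>A\<^esub> \<chi> h" "\<chi> \<zero>\<^bsub>L\<^esub> = \<zero>\<^bsub>A\<^esub>"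
proof -
  interpret \<chi>: linear_map F K A \<chi> using assms by (rule linear_map_K)
  show "h \<in> H \<Longrightarrow> \<chi> h \<in> carrier A" "\<lbrakk>h \<in> H; h' \<in> H\<rbrakk> \<Longrightarrow> \<chi> (h \<oplus>\<^bsub>L\<^esub> h') = \<chi> h \<oplus>\<^bsub>A\<^esub> \<chi> h'"
    "\<lbrakk>a \<in> carrier F; h \<in> H\<rbrakk> \<Longrightarrow> \<chi> (a \<odot>\<^bsub>L\<^esub> h) = a \<odot>\<^bsub>A\<^esub> \<chi> h" "\<chi> \<zero>\<^bsub>L\<^esub> = \<zero>\<^bsub>A\<^esub>"
    using \<chi>.map_closed[of h] \<chi>.map_add[of h h'] \<chi>.map_smult[of a h] \<chi>.map_zero by simp_all
qed

text \<open>Products inside a central ideal are zero, so linear maps on H satisfy the product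
  condition automatically. This makes any restriction of a linear map on L an admissible argument of
  \<open>Tra\<close>.\<close>

lemma carrier_Hom_ideal: "carrier (Hom F K A) = linear_maps F K A"
  by (auto simp: Hom_def CK.dialgebra_hom_iff prod_ideal a_Hcarr linear_map_ideal(4))

lemma carrier_Hom_L: "\<pi> \<in> carrier (Hom F L A) \<longleftrightarrow> \<pi> \<in> linear_maps F L A \<and>
    (\<forall>x\<in>carrier L. \<forall>y\<in>carrier L. \<pi> (x \<stileturn>\<^bsub>L\<^esub> y) = \<zero>\<^bsub>A\<^esub> \<and> \<pi> (x \<turnstile>\<^bsub>L\<^esub> y) = \<zero>\<^bsub>A\<^esub>)"
  by (simp add: Hom_def CL.dialgebra_hom_iff)

lemma carrier_Hom_Q: "\<pi> \<in> carrier (Hom F Q A) \<longleftrightarrow> \<pi> \<in> linear_maps F Q A \<and>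
    (\<forall>x\<in>carrier Q. \<forall>y\<in>carrier Q. \<pi> (x \<stileturn>\<^bsub>Q\<^esub> y) = \<zero>\<^bsub>A\<^esub> \<and> \<pi> (x \<turnstile>\<^bsub>Q\<^esub> y) = \<zero>\<^bsub>A\<^esub>)"
  by (simp add: Hom_def CQ.dialgebra_hom_iff)

text \<open>The composite of \<chi> with the projection of L onto H along the image of
  \<mu>.\<close>

definition extend_by_section :: "('l \<Rightarrow> 'a) \<Rightarrow> 'l \<Rightarrow> 'a" where
  "extend_by_section \<chi> = (\<lambda>x\<in>carrier L. \<chi> (x \<ominus>\<^bsub>L\<^esub> \<mu> (\<beta> x)))"

lemma extend_by_section_linear:
  assumes "\<chi> \<in> linear_maps F K A"
  shows "extend_by_section \<chi> \<in> linear_maps F L A"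
proof (rule linear_mapsI)
  fix x y assume xy: "x \<in> carrier L" "y \<in> carrier L"
  have "x \<oplus>\<^bsub>L\<^esub> y \<ominus>\<^bsub>L\<^esub> \<mu> (\<beta> (x \<oplus>\<^bsub>L\<^esub> y)) = (x \<ominus>\<^bsub>L\<^esub> \<mu> (\<beta> x)) \<oplus>\<^bsub>L\<^esub> (y \<ominus>\<^bsub>L\<^esub> \<mu> (\<beta> y))"
    using xy by (simp add: \<beta>.map_add \<mu>.map_add a_minus_def M.minus_add M.a_ac)
  then show "extend_by_section \<chi> (x \<oplus>\<^bsub>L\<^esub> y) = extend_by_section \<chi> x \<oplus>\<^bsub>A\<^esub> extend_by_section \<chi> y"
    using xy by (simp add: extend_by_section_def linear_map_ideal[OF assms] diff_in_ideal)
next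
  fix a x assume ax: "a \<in> carrier F" "x \<in> carrier L"
  then show "extend_by_section \<chi> (a \<odot>\<^bsub>L\<^esub> x) = a \<odot>\<^bsub>A\<^esub> extend_by_section \<chi> x"
    by (simp add: extend_by_section_def \<beta>.map_smult \<mu>.map_smult smult_minus
        linear_map_ideal[OF assms] diff_in_ideal)
qed (auto simp: extend_by_section_def linear_map_ideal[OF assms] diff_in_ideal)

section \<open>Transgression as the class of a section cocycle\<close>

lemma section_diff_in_ideal:
  assumes "X \<in> carrier Q" "Y \<in> carrier Q"
  shows "\<mu> X \<stileturn>\<^bsub>L\<^esub> \<mu> Y \<ominus>\<^bsub>L\<^esub> \<mu> (X \<stileturn>\<^bsub>Q\<^esub> Y) \<in> H" "\<mu> X \<turnstile>\<^bsub>L\<^esub> \<mu> Y \<ominus>\<^bsub>L\<^esub> \<mu> (X \<turnstile>\<^bsub>Q\<^esub> Y) \<in> H"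
  using diff_in_ideal[of "\<mu> X \<stileturn>\<^bsub>L\<^esub> \<mu> Y"] diff_in_ideal[of "\<mu> X \<turnstile>\<^bsub>L\<^esub> \<mu> Y"] assms
  by (simp_all add: \<beta>_prod)

lemma extend_by_section_ideal: "h \<in> H \<Longrightarrow> extend_by_section \<chi> h = \<chi> h"
proof -
  have "\<ominus>\<^bsub>L\<^esub> \<zero>\<^bsub>L\<^esub> = \<zero>\<^bsub>L\<^esub>"
    using M.minus_equality[of "\<zero>\<^bsub>L\<^esub>" "\<zero>\<^bsub>L\<^esub>"] by simp
  then have "h \<ominus>\<^bsub>L\<^esub> \<zero>\<^bsub>L\<^esub> = h" if "h \<in> H"
    using that by (simp add: M.minus_eq a_Hcarr)
  then show "h \<in> H \<Longrightarrow> extend_by_section \<chi> h = \<chi> h"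
    by (simp add: extend_by_section_def \<beta>_ideal a_Hcarr)
qed

text \<open>For w the product of \<mu> X and \<mu> Y, the lift \<mu> (\<beta> w) is the lift of the
  product of X and Y. The argument of \<chi> in the definition of \<open>Tra\<close> is therefore w
  - \<mu> (\<beta> w), and \<chi> there is the extended map at w.\<close>

lemma Tra_eq:
  assumes "\<chi> \<in> carrier (Hom F K A)"
  shows "Tra F L H \<mu> A \<chi> = B2 F Q A +>\<^bsub>Z2 F Q A\<^esub> section_cocycle (extend_by_section \<chi>)"
proof -
  have "(compose (carrier Q \<times> carrier Q) \<chi> (\<lambda>(X, Y). \<mu> X \<stileturn>\<^bsub>L\<^esub> \<mu> Y \<ominus>\<^bsub>L\<^esub> \<mu> (X \<stileturn>\<^bsub>Q\<^esub> Y)),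
      compose (carrier Q \<times> carrier Q) \<chi> (\<lambda>(X, Y). \<mu> X \<turnstile>\<^bsub>L\<^esub> \<mu> Y \<ominus>\<^bsub>L\<^esub> \<mu> (X \<turnstile>\<^bsub>Q\<^esub> Y))) =
    section_cocycle (extend_by_section \<chi>)"
    by (auto simp: section_cocycle_def extend_by_section_def compose_def \<beta>_prod fun_eq_iff)
  then show ?thesis
    using assms by (simp add: Tra_def Let_def cohomology_class_def)
qed

lemma Tra_linear: "Tra F L H \<mu> A \<in> linear_maps F (Hom F K A) (H2 F Q A)"
proof -
  \<comment> \<open>\<open>Tra\<close> factors as this map into \<open>Z2\<close> followed by the
    projection to classes, so its linearity is checked on cocycles.\<close>
  let ?T = "\<lambda>\<chi>\<in>carrier (Hom F K A). section_cocycle (extend_by_section \<chi>)"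
  have "?T \<in> linear_maps F (Hom F K A) (Z2 F Q A)"
  proof (rule linear_mapsI)
    fix \<chi> assume "\<chi> \<in> carrier (Hom F K A)"
    then show "?T \<chi> \<in> carrier (Z2 F Q A)"
      using section_cocycle_closed[OF extend_by_section_linear] by (simp add: carrier_Hom_ideal)
  next
    interpret HK: vec_space F "Hom F K A" by (rule CK.Hom_vec_space)
    fix \<chi> \<psi> assume h: "\<chi> \<in> carrier (Hom F K A)" "\<psi> \<in> carrier (Hom F K A)"
    have "section_cocycle (extend_by_section (\<chi> \<oplus>\<^bsub>Hom F K A\<^esub> \<psi>)) =
        section_cocycle (extend_by_section \<chi>) \<oplus>\<^bsub>Z2 F Q A\<^esub> section_cocycle (extend_by_section \<psi>)"
      by (auto simp: section_cocycle_def extend_by_section_def Z2_def Hom_def diff_in_ideal fun_eq_iff)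
    then show "?T (\<chi> \<oplus>\<^bsub>Hom F K A\<^esub> \<psi>) = ?T \<chi> \<oplus>\<^bsub>Z2 F Q A\<^esub> ?T \<psi>"
      using h HK.M.a_closed[OF h] by simp
  next
    interpret HK: vec_space F "Hom F K A" by (rule CK.Hom_vec_space)
    fix a \<chi> assume h: "a \<in> carrier F" "\<chi> \<in> carrier (Hom F K A)"
    have "section_cocycle (extend_by_section (a \<odot>\<^bsub>Hom F K A\<^esub> \<chi>)) =
        a \<odot>\<^bsub>Z2 F Q A\<^esub> section_cocycle (extend_by_section \<chi>)"
      by (auto simp: section_cocycle_def extend_by_section_def Z2_def Hom_def diff_in_ideal fun_eq_iff)
    then show "?T (a \<odot>\<^bsub>Hom F K A\<^esub> \<chi>) = a \<odot>\<^bsub>Z2 F Q A\<^esub> ?T \<chi>"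
      using h HK.smult_closed[OF h] by simp
  qed simp
  note T = linear_maps_compose[OF CK.Hom_vec_space this CQ.Z2.coset_linear]
  have "Tra F L H \<mu> A = compose (carrier (Hom F K A)) (\<lambda>x\<in>carrier (Z2 F Q A). B2 F Q A +>\<^bsub>Z2 F Q A\<^esub> x) ?T"
  proof (rule extensionalityI[of _ "carrier (Hom F K A)"])
    show "Tra F L H \<mu> A \<in> extensional (carrier (Hom F K A))" by (simp add: Tra_def)
  qed (auto simp: Tra_eq compose_def carrier_Hom_ideal section_cocycle_closed extend_by_section_linear
      simp del: split_paired_All)
  then show ?thesis using T by (simp add: H2_def)
qed

text \<open>Brings \<open>Inf2\<close> into the shape of \<open>induced_linear\<close>. That lemma
  takes a linear map on \<open>Z2\<close>, hence an extensional one, which is why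
  \<open>inflate\<close> appears restricted.\<close>

lemma Inf2_eq: "Inf2 F L H A = (\<lambda>X\<in>carrier (FactModule (Z2 F Q A) (B2 F Q A)).
    \<Union>\<phi>\<in>X. B2 F L A +>\<^bsub>Z2 F L A\<^esub> restrict inflate (cocycles2 F Q A) \<phi>)"
proof -
  have "(\<Union>(f, g)\<in>X. cohomology_class F L A
         (\<lambda>(x, y)\<in>carrier L \<times> carrier L. f (\<beta> x, \<beta> y), \<lambda>(x, y)\<in>carrier L \<times> carrier L. g (\<beta> x, \<beta> y))) =
      (\<Union>\<phi>\<in>X. B2 F L A +>\<^bsub>Z2 F L A\<^esub> restrict inflate (cocycles2 F Q A) \<phi>)"
    if "X \<in> carrier (FactModule (Z2 F Q A) (B2 F Q A))" for X
  proof -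
    \<comment> \<open>A class consists of cocycles, so the restriction does not affect the
      union.\<close>
    have "X \<subseteq> cocycles2 F Q A"
      using CQ.Z2.a_rcosets_carrier[of X] that by (simp add: FactModule_def)
    then show ?thesis
      by (intro SUP_cong refl) (auto simp: inflate_def cohomology_class_def)
  qed
  then show ?thesis unfolding Inf2_def H2_def by (rule restrict_ext)
qed

sublocale inflate: linear_map F "Z2 F Q A" "Z2 F L A" "restrict inflate (cocycles2 F Q A)"
  by (intro linear_mapI CQ.Z2_vec_space CL.Z2_vec_space inflate_linear)

lemma restrict_inflate_B2: "restrict inflate (cocycles2 F Q A) ` B2 F Q A \<subseteq> B2 F L A"
  using inflate_B2 CQ.Z2.subset by auto

lemma Inf2_linear: "Inf2 F L H A \<in> linear_maps F (H2 F Q A) (H2 F L A)"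
  unfolding Inf2_eq H2_def
  by (intro induced_linear CQ.Z2.quotient_space_axioms CL.Z2.quotient_space_axioms
      inflate.linear_map_axioms restrict_inflate_B2)

lemma Inf2_class:
  assumes "\<phi> \<in> cocycles2 F Q A"
  shows "Inf2 F L H A (B2 F Q A +>\<^bsub>Z2 F Q A\<^esub> \<phi>) = B2 F L A +>\<^bsub>Z2 F L A\<^esub> inflate \<phi>"
  using assms UN_induced[OF CQ.Z2.quotient_space_axioms CL.Z2.quotient_space_axioms
      inflate.linear_map_axioms restrict_inflate_B2, of \<phi>]
  by (simp add: Inf2_eq CQ.Z2.carrier_quotient)

section \<open>Inflation and restriction of homomorphisms\<close>

lemma zero_Hom: "\<zero>\<^bsub>Hom F B A\<^esub> = (\<lambda>x\<in>carrier B. \<zero>\<^bsub>A\<^esub>)"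
  by (simp add: Hom_def)

lemma Inf1_eq: "\<chi> \<in> carrier (Hom F Q A) \<Longrightarrow> Inf1 F L H A \<chi> = compose (carrier L) \<chi> \<beta>"
  by (simp add: Inf1_def)

lemma Res_eq: "\<pi> \<in> carrier (Hom F L A) \<Longrightarrow> Res F L H A \<pi> = restrict \<pi> H"
  by (simp add: Res_def)

lemma Inf1_linear: "Inf1 F L H A \<in> linear_maps F (Hom F Q A) (Hom F L A)"
proof (rule linear_mapsI)
  interpret HQ: vec_space F "Hom F Q A" by (rule CQ.Hom_vec_space)
  show "Inf1 F L H A \<in> extensional (carrier (Hom F Q A))" by (simp add: Inf1_def)
  show "Inf1 F L H A \<chi> \<in> carrier (Hom F L A)" if \<chi>: "\<chi> \<in> carrier (Hom F Q A)" for \<chi>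
    using \<chi> linear_maps_compose[OF vec_space_axioms \<beta>.linear, of \<chi> A]
    by (simp add: Inf1_eq[OF \<chi>] carrier_Hom_Q carrier_Hom_L compose_def \<beta>_prod)
  show "Inf1 F L H A (\<chi> \<oplus>\<^bsub>Hom F Q A\<^esub> \<psi>) = Inf1 F L H A \<chi> \<oplus>\<^bsub>Hom F L A\<^esub> Inf1 F L H A \<psi>"
    if h: "\<chi> \<in> carrier (Hom F Q A)" "\<psi> \<in> carrier (Hom F Q A)" for \<chi> \<psi>
    unfolding Inf1_eq[OF h(1)] Inf1_eq[OF h(2)] Inf1_eq[OF HQ.M.a_closed[OF h]]
    by (auto simp: Hom_def compose_def)
  show "Inf1 F L H A (a \<odot>\<^bsub>Hom F Q A\<^esub> \<chi>) = a \<odot>\<^bsub>Hom F L A\<^esub> Inf1 F L H A \<chi>"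
    if h: "a \<in> carrier F" "\<chi> \<in> carrier (Hom F Q A)" for a \<chi>
    unfolding Inf1_eq[OF h(2)] Inf1_eq[OF HQ.smult_closed[OF h]]
    by (auto simp: Hom_def compose_def)
qed

lemma Res_linear: "Res F L H A \<in> linear_maps F (Hom F L A) (Hom F K A)"
proof (rule linear_mapsI)
  interpret HL: vec_space F "Hom F L A" by (rule CL.Hom_vec_space)
  show "Res F L H A \<in> extensional (carrier (Hom F L A))" by (simp add: Res_def)
  show "Res F L H A \<chi> \<in> carrier (Hom F K A)" if \<chi>: "\<chi> \<in> carrier (Hom F L A)" for \<chi>
    using \<chi> linear_maps_restrict[OF _ submodule_axioms, of \<chi> A]
    by (simp add: Res_eq[OF \<chi>] carrier_Hom_L carrier_Hom_ideal)
  show "Res F L H A (\<chi> \<oplus>\<^bsub>Hom F L A\<^esub> \<psi>) = Res F L H A \<chi> \<oplus>\<^bsub>Hom F K A\<^esub> Res F L H A \<psi>"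
    if h: "\<chi> \<in> carrier (Hom F L A)" "\<psi> \<in> carrier (Hom F L A)" for \<chi> \<psi>
    unfolding Res_eq[OF h(1)] Res_eq[OF h(2)] Res_eq[OF HL.M.a_closed[OF h]]
    by (auto simp: Hom_def a_Hcarr fun_eq_iff)
  show "Res F L H A (a \<odot>\<^bsub>Hom F L A\<^esub> \<chi>) = a \<odot>\<^bsub>Hom F K A\<^esub> Res F L H A \<chi>"
    if h: "a \<in> carrier F" "\<chi> \<in> carrier (Hom F L A)" for a \<chi>
    unfolding Res_eq[OF h(2)] Res_eq[OF HL.smult_closed[OF h]]
    by (auto simp: Hom_def a_Hcarr fun_eq_iff)
qed

section \<open>Exactness at the four places\<close>

lemma exact_Hom_quotient:
  "exact_at F zero_module (\<lambda>_\<in>carrier zero_module. \<zero>\<^bsub>Hom F Q A\<^esub>) (Hom F Q A) (Inf1 F L H A) (Hom F L A)"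
proof -
  interpret I: linear_map F "Hom F Q A" "Hom F L A" "Inf1 F L H A"
    by (intro linear_mapI CQ.Hom_vec_space CL.Hom_vec_space Inf1_linear)
  have "linear_map F zero_module (Hom F Q A) (\<lambda>_\<in>carrier zero_module. \<zero>\<^bsub>Hom F Q A\<^esub>)"
    by (intro linear_mapI zero_module_vec_space field_axioms CQ.Hom_vec_space linear_mapsI)
      (auto simp: zero_module_def)
  moreover have "\<chi> = \<zero>\<^bsub>Hom F Q A\<^esub>"
    if \<chi>: "\<chi> \<in> carrier (Hom F Q A)" and 0: "Inf1 F L H A \<chi> = \<zero>\<^bsub>Hom F L A\<^esub>" for \<chi>
  proof (rule extensionalityI[of _ "carrier Q"])
    show "\<chi> \<in> extensional (carrier Q)"
      using \<chi> by (simp add: carrier_Hom_Q linear_maps_def PiE_def)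
    \<comment> \<open>Injectivity of \<open>Inf1\<close> comes from surjectivity of \<beta>:
      evaluating the zero map \<chi> o \<beta> at \<mu> X gives the value of \<chi> at X.\<close>
    fix X assume X: "X \<in> carrier Q"
    show "\<chi> X = \<zero>\<^bsub>Hom F Q A\<^esub> X"
      using fun_cong[OF 0, of "\<mu> X"] X by (simp add: Inf1_eq[OF \<chi>] zero_Hom compose_def)
  qed (simp add: zero_Hom)
  ultimately show ?thesis
    unfolding exact_at_def by (auto simp: a_kernel_def' zero_module_def I.linear_map_axioms)
qed

text \<open>A composite with \<beta> vanishes on H because \<beta> does. Conversely, if \<pi>
  vanishes on H, then it vanishes at x - \<mu> (\<beta> x), so \<pi> = (\<pi> o \<mu>) o \<beta>;
  the section thus supplies the map on the quotient without a choice of representatives.\<close>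

lemma exact_Hom:
  "exact_at F (Hom F Q A) (Inf1 F L H A) (Hom F L A) (Res F L H A) (Hom F K A)"
  unfolding exact_at_def
proof (intro conjI)
  show I: "linear_map F (Hom F Q A) (Hom F L A) (Inf1 F L H A)"
    by (intro linear_mapI CQ.Hom_vec_space CL.Hom_vec_space Inf1_linear)
  show "linear_map F (Hom F L A) (Hom F K A) (Res F L H A)"
    by (intro linear_mapI CK.Hom_vec_space CL.Hom_vec_space Res_linear)
  interpret I: linear_map F "Hom F Q A" "Hom F L A" "Inf1 F L H A" by (rule I)
  show "Inf1 F L H A ` carrier (Hom F Q A) = a_kernel (Hom F L A) (Hom F K A) (Res F L H A)"
  proof (intro subset_antisym subsetI)
    fix \<pi> assume "\<pi> \<in> Inf1 F L H A ` carrier (Hom F Q A)"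
    then obtain \<chi> where \<chi>: "\<chi> \<in> carrier (Hom F Q A)" and \<pi>: "\<pi> = Inf1 F L H A \<chi>" by (rule imageE)
    interpret \<chi>: linear_map F Q A \<chi> using \<chi> by (intro linear_map_Q) (simp add: carrier_Hom_Q)
    have "\<pi> \<in> carrier (Hom F L A)" using \<chi> \<pi> by simp
    moreover have "Res F L H A \<pi> = \<zero>\<^bsub>Hom F K A\<^esub>"
      unfolding Res_eq[OF \<open>\<pi> \<in> carrier (Hom F L A)\<close>] unfolding \<pi> Inf1_eq[OF \<chi>] zero_Hom
      by (auto simp: compose_def \<beta>_ideal a_Hcarr fun_eq_iff)
    ultimately show "\<pi> \<in> a_kernel (Hom F L A) (Hom F K A) (Res F L H A)"
      by (simp add: a_kernel_def')
  next
    fix \<pi> assume "\<pi> \<in> a_kernel (Hom F L A) (Hom F K A) (Res F L H A)"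
    then have \<pi>: "\<pi> \<in> carrier (Hom F L A)" and res: "Res F L H A \<pi> = \<zero>\<^bsub>Hom F K A\<^esub>"
      by (simp_all add: a_kernel_def')
    interpret \<pi>: linear_map F L A \<pi> using \<pi> by (intro linear_map_L) (simp add: carrier_Hom_L)
    have \<pi>_H: "\<pi> h = \<zero>\<^bsub>A\<^esub>" if "h \<in> H" for h
      using fun_cong[OF res, of h] that by (simp add: Res_eq[OF \<pi>] zero_Hom)
    have \<pi>_\<mu>: "\<pi> (\<mu> (\<beta> x)) = \<pi> x" if x: "x \<in> carrier L" for x
      using \<pi>_H[OF diff_in_ideal[OF x]] x
      by (metis A.M.minus_equality A.M.minus_minus A.M.a_inv_closed \<pi>.map_closed \<pi>.map_minus
          \<mu>.map_closed \<beta>.map_closed a_minus_def A.M.r_neg)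
    let ?\<chi> = "compose (carrier Q) \<pi> \<mu>"
    have \<chi>: "?\<chi> \<in> carrier (Hom F Q A)"
    proof -
      \<comment> \<open>The product of X and Y is \<beta> of the product of their lifts, so by
        \<open>\<pi>_\<mu>\<close> the value is \<pi> of a product in L, which is zero. Linearity of
        \<mu> alone would not give this.\<close>
      have "\<pi> (\<mu> (X \<stileturn>\<^bsub>Q\<^esub> Y)) = \<zero>\<^bsub>A\<^esub>" "\<pi> (\<mu> (X \<turnstile>\<^bsub>Q\<^esub> Y)) = \<zero>\<^bsub>A\<^esub>"
        if "X \<in> carrier Q" "Y \<in> carrier Q" for X Y
        using \<pi>_\<mu>[of "\<mu> X \<stileturn>\<^bsub>L\<^esub> \<mu> Y"] \<pi>_\<mu>[of "\<mu> X \<turnstile>\<^bsub>L\<^esub> \<mu> Y"] that \<pi>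
        by (simp_all add: \<beta>_prod carrier_Hom_L)
      then show ?thesis
        using linear_maps_compose[OF CQ.B.vec_space_axioms \<mu>.linear \<pi>.linear]
        by (simp add: carrier_Hom_Q compose_def)
    qed
    moreover have "\<pi> = Inf1 F L H A ?\<chi>"
      unfolding Inf1_eq[OF \<chi>]
      by (rule extensionalityI[of _ "carrier L"]) (simp_all add: \<pi>.map_ext compose_def \<pi>_\<mu>)
    ultimately show "\<pi> \<in> Inf1 F L H A ` carrier (Hom F Q A)"
      by (intro image_eqI[of \<pi> "Inf1 F L H A" ?\<chi>])
  qed
qed

lemma exact_Hom_ideal:
  "exact_at F (Hom F L A) (Res F L H A) (Hom F K A) (Tra F L H \<mu> A) (H2 F Q A)"
  unfolding exact_at_def
proof (intro conjI)
  show R: "linear_map F (Hom F L A) (Hom F K A) (Res F L H A)"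
    by (intro linear_mapI CK.Hom_vec_space CL.Hom_vec_space Res_linear)
  show "linear_map F (Hom F K A) (H2 F Q A) (Tra F L H \<mu> A)"
    unfolding H2_def
    by (intro linear_mapI CK.Hom_vec_space CQ.Z2.quotient_vec_space Tra_linear[unfolded H2_def])
  interpret R: linear_map F "Hom F L A" "Hom F K A" "Res F L H A" by (rule R)
  have Tra_zero_iff: "Tra F L H \<mu> A \<chi> = \<zero>\<^bsub>H2 F Q A\<^esub> \<longleftrightarrow>
      section_cocycle (extend_by_section \<chi>) \<in> B2 F Q A" if "\<chi> \<in> carrier (Hom F K A)" for \<chi>
    using that section_cocycle_closed[OF extend_by_section_linear, of \<chi>]
    by (simp add: Tra_eq H2_def CQ.Z2.zero_quotient CQ.Z2.coset_eq_self_iff carrier_Hom_ideal)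
  show "Res F L H A ` carrier (Hom F L A) = a_kernel (Hom F K A) (H2 F Q A) (Tra F L H \<mu> A)"
  proof (intro subset_antisym subsetI)
    fix \<chi> assume "\<chi> \<in> Res F L H A ` carrier (Hom F L A)"
    then obtain \<pi> where \<pi>: "\<pi> \<in> carrier (Hom F L A)" and \<chi>: "\<chi> = Res F L H A \<pi>" by (rule imageE)
    interpret \<pi>: linear_map F L A \<pi> using \<pi> by (intro linear_map_L) (simp add: carrier_Hom_L)
    \<comment> \<open>As \<chi> is the restriction of \<pi>, the cocycle is \<pi> of the product of
      lifts minus \<pi> of the lift of the product. The first term is zero because \<pi> kills
      products; what remains is the coboundary of \<pi> o \<mu>.\<close>
    have "section_cocycle (extend_by_section \<chi>) = coboundary Q A (compose (carrier Q) \<pi> \<mu>)"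
      using \<pi> unfolding \<chi> Res_eq[OF \<pi>] carrier_Hom_L
      by (auto simp: section_cocycle_def extend_by_section_def coboundary_def compose_def
          section_diff_in_ideal \<pi>.map_minus \<beta>_prod A.M.minus_eq fun_eq_iff)
    then have "section_cocycle (extend_by_section \<chi>) \<in> B2 F Q A"
      using linear_maps_compose[OF CQ.B.vec_space_axioms \<mu>.linear \<pi>.linear]
      by (simp add: CQ.B2_eq)
    moreover have "\<chi> \<in> carrier (Hom F K A)" using \<pi> \<chi> by simp
    ultimately show "\<chi> \<in> a_kernel (Hom F K A) (H2 F Q A) (Tra F L H \<mu> A)"
      by (simp add: a_kernel_def' Tra_zero_iff)
  next
    fix \<chi> assume "\<chi> \<in> a_kernel (Hom F K A) (H2 F Q A) (Tra F L H \<mu> A)"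
    then have \<chi>: "\<chi> \<in> carrier (Hom F K A)"
      and "section_cocycle (extend_by_section \<chi>) \<in> B2 F Q A"
      by (auto simp: a_kernel_def' Tra_zero_iff)
    then obtain \<epsilon> where \<epsilon>: "\<epsilon> \<in> linear_maps F Q A"
      and eq: "section_cocycle (extend_by_section \<chi>) = coboundary Q A \<epsilon>"
      by (auto simp: CQ.B2_eq)
    have \<chi>_lin: "\<chi> \<in> linear_maps F K A" using \<chi> by (simp add: carrier_Hom_ideal)
    let ?p = "extend_by_section \<chi>"
    interpret p: linear_map F L A ?p by (rule linear_map_L[OF extend_by_section_linear[OF \<chi>_lin]])
    interpret \<epsilon>: linear_map F Q A \<epsilon> using \<epsilon> by (rule linear_map_Q)
    \<comment> \<open>On products \<open>?p\<close> equals minus \<epsilon> o \<beta>, so the sum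
      kills products. On H the map \<epsilon> o \<beta> is zero, so adding it leaves the restriction
      \<chi> unchanged.\<close>
    define \<pi> where "\<pi> = (\<lambda>x\<in>carrier L. ?p x \<oplus>\<^bsub>A\<^esub> \<epsilon> (\<beta> x))"
    \<comment> \<open>This is \<open>eq\<close> evaluated at (\<beta> x, \<beta> y), where the
      product of the lifts equals the product of x and y.\<close>
    have p_prod: "?p (x \<stileturn>\<^bsub>L\<^esub> y) = \<ominus>\<^bsub>A\<^esub> \<epsilon> (\<beta> x \<stileturn>\<^bsub>Q\<^esub> \<beta> y)" "?p (x \<turnstile>\<^bsub>L\<^esub> y) = \<ominus>\<^bsub>A\<^esub> \<epsilon> (\<beta> x \<turnstile>\<^bsub>Q\<^esub> \<beta> y)"
      if "x \<in> carrier L" "y \<in> carrier L" for x y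
      using fun_cong[OF arg_cong[OF eq, of fst], of "(\<beta> x, \<beta> y)"]
        fun_cong[OF arg_cong[OF eq, of snd], of "(\<beta> x, \<beta> y)"] that
      by (simp_all add: section_cocycle_def coboundary_def prod_\<mu>_\<beta>)
    have "\<pi> \<in> linear_maps F L A"
      unfolding \<pi>_def
      by (rule linear_mapsI) (auto simp: p.map_add p.map_smult \<beta>.map_add \<beta>.map_smult \<epsilon>.map_add
          \<epsilon>.map_smult A.M.a_ac A.smult_r_distr)
    then have \<pi>: "\<pi> \<in> carrier (Hom F L A)"
      by (simp add: carrier_Hom_L) (simp add: \<pi>_def p_prod \<beta>_prod A.M.l_neg)
    moreover have "\<chi> = Res F L H A \<pi>"
      unfolding Res_eq[OF \<pi>]
    proof (rule extensionalityI[of _ H])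
      show "\<chi> \<in> extensional H" using linear_map.map_ext[OF linear_map_K[OF \<chi>_lin]] by simp
      show "\<chi> h = restrict \<pi> H h" if "h \<in> H" for h
        using that by (simp add: \<pi>_def a_Hcarr \<beta>_ideal extend_by_section_ideal
            linear_map_ideal[OF \<chi>_lin])
    qed simp
    ultimately show "\<chi> \<in> Res F L H A ` carrier (Hom F L A)"
      by (intro image_eqI[of \<chi> "Res F L H A" \<pi>])
  qed
qed

lemma exact_H2_quotient:
  "exact_at F (Hom F K A) (Tra F L H \<mu> A) (H2 F Q A) (Inf2 F L H A) (H2 F L A)"
  unfolding exact_at_def
proof (intro conjI)
  show T: "linear_map F (Hom F K A) (H2 F Q A) (Tra F L H \<mu> A)"
    unfolding H2_def
    by (intro linear_mapI CK.Hom_vec_space CQ.Z2.quotient_vec_space Tra_linear[unfolded H2_def])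
  show "linear_map F (H2 F Q A) (H2 F L A) (Inf2 F L H A)"
    unfolding H2_def
    by (intro linear_mapI CQ.Z2.quotient_vec_space CL.Z2.quotient_vec_space
        Inf2_linear[unfolded H2_def])
  interpret T: linear_map F "Hom F K A" "H2 F Q A" "Tra F L H \<mu> A" by (rule T)
  have Inf2_zero_iff: "Inf2 F L H A (B2 F Q A +>\<^bsub>Z2 F Q A\<^esub> \<phi>) = \<zero>\<^bsub>H2 F L A\<^esub> \<longleftrightarrow> inflate \<phi> \<in> B2 F L A"
    if "\<phi> \<in> cocycles2 F Q A" for \<phi>
    using that inflate_closed[OF that]
    by (simp add: Inf2_class H2_def CL.Z2.zero_quotient CL.Z2.coset_eq_self_iff)
  show "Tra F L H \<mu> A ` carrier (Hom F K A) = a_kernel (H2 F Q A) (H2 F L A) (Inf2 F L H A)"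
  proof (intro subset_antisym subsetI)
    fix X assume "X \<in> Tra F L H \<mu> A ` carrier (Hom F K A)"
    then obtain \<chi> where \<chi>: "\<chi> \<in> carrier (Hom F K A)" and X: "X = Tra F L H \<mu> A \<chi>" by (rule imageE)
    let ?p = "extend_by_section \<chi>"
    have p: "?p \<in> linear_maps F L A"
      using \<chi> by (intro extend_by_section_linear) (simp add: carrier_Hom_ideal)
    interpret p: linear_map F L A ?p by (rule linear_map_L[OF p])
    \<comment> \<open>The linear map whose coboundary is the inflated transgression cocycle.\<close>
    have "(\<lambda>x\<in>carrier L. \<ominus>\<^bsub>A\<^esub> ?p x) \<in> linear_maps F L A"
      by (rule linear_mapsI) (auto simp: p.map_add p.map_smult A.M.minus_add A.smult_r_minus)
    then have "Inf2 F L H A X = \<zero>\<^bsub>H2 F L A\<^esub>"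
      unfolding X Tra_eq[OF \<chi>] Inf2_zero_iff[OF section_cocycle_closed[OF p]]
      by (simp add: inflate_section_cocycle[OF p] CL.B2_eq)
    moreover have "X \<in> carrier (H2 F Q A)" using \<chi> X by simp
    ultimately show "X \<in> a_kernel (H2 F Q A) (H2 F L A) (Inf2 F L H A)"
      by (simp add: a_kernel_def')
  next
    fix X assume "X \<in> a_kernel (H2 F Q A) (H2 F L A) (Inf2 F L H A)"
    then have "X \<in> carrier (FactModule (Z2 F Q A) (B2 F Q A))" "Inf2 F L H A X = \<zero>\<^bsub>H2 F L A\<^esub>"
      by (simp_all add: a_kernel_def' H2_def)
    then obtain \<phi> where \<phi>: "\<phi> \<in> cocycles2 F Q A" and X: "X = B2 F Q A +>\<^bsub>Z2 F Q A\<^esub> \<phi>"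
      and "inflate \<phi> \<in> B2 F L A"
      by (auto elim!: CQ.Z2.quotientE simp: Inf2_zero_iff simp del: split_paired_All split_paired_Ex)
    then obtain \<epsilon> where \<epsilon>: "\<epsilon> \<in> linear_maps F L A" and eq: "inflate \<phi> = coboundary L A \<epsilon>"
      unfolding CL.B2_eq by (auto elim!: imageE)
    interpret \<epsilon>: linear_map F L A \<epsilon> using \<epsilon> by (rule linear_map_L)
    obtain f g where fg: "\<phi> = (f, g)" by fastforce
    \<comment> \<open>Evaluating \<open>eq\<close> at lifts recovers the cocycle itself, since
      \<beta> (\<mu> X) = X. Hence the cocycle is that of the linear map -\<epsilon>.\<close>
    have f: "f (X, Y) = \<ominus>\<^bsub>A\<^esub> \<epsilon> (\<mu> X \<stileturn>\<^bsub>L\<^esub> \<mu> Y)" and g: "g (X, Y) = \<ominus>\<^bsub>A\<^esub> \<epsilon> (\<mu> X \<turnstile>\<^bsub>L\<^esub> \<mu> Y)"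
      if "X \<in> carrier Q" "Y \<in> carrier Q" for X Y
      using fun_cong[OF arg_cong[OF eq, of fst], of "(\<mu> X, \<mu> Y)"]
        fun_cong[OF arg_cong[OF eq, of snd], of "(\<mu> X, \<mu> Y)"] that
      by (simp_all add: fg inflate_def coboundary_def)
    \<comment> \<open>Needed for equality of functions: outside the carrier both sides of the
      decomposition below must be \<open>undefined\<close>.\<close>
    have ext: "f \<in> extensional (carrier Q \<times> carrier Q)" "g \<in> extensional (carrier Q \<times> carrier Q)"
      using \<phi> by (simp_all add: fg CQ.cocycles2_iff bilinear_maps_def PiE_def)
    \<comment> \<open>The sign follows the formulas for \<open>f\<close> and \<open>g\<close>.
      Although \<epsilon> may be nonzero on products of L, its restriction to H is a homomorphism,
      since products in H are zero.\<close>
    define \<chi> where "\<chi> = (\<lambda>h\<in>H. \<ominus>\<^bsub>A\<^esub> \<epsilon> h)"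
    have \<chi>_lin: "\<chi> \<in> linear_maps F K A"
      unfolding \<chi>_def
      by (rule linear_mapsI) (auto simp: a_Hcarr \<epsilon>.map_add \<epsilon>.map_smult A.M.minus_add A.smult_r_minus)
    then have \<chi>: "\<chi> \<in> carrier (Hom F K A)" by (simp add: carrier_Hom_ideal)
    let ?c = "section_cocycle (extend_by_section \<chi>)"
    let ?\<kappa> = "compose (carrier Q) \<epsilon> \<mu>"
    \<comment> \<open>Pointwise this is -a = -b + -(a - b), with a the value of \<epsilon> at the
      product of lifts and b its value at the lift of the product. Here -b belongs to the coboundary
      of \<epsilon> o \<mu>, and -(a - b) is \<chi> at an element of H. The coboundary stands on the
      left because a member of the coset of \<open>?c\<close> is an element of \<open>B2\<close>
      plus \<open>?c\<close>.\<close>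
    have "\<phi> = coboundary Q A ?\<kappa> \<oplus>\<^bsub>Z2 F Q A\<^esub> ?c"
    proof -
      have cancel: "\<ominus>\<^bsub>A\<^esub> a = \<ominus>\<^bsub>A\<^esub> b \<oplus>\<^bsub>A\<^esub> \<ominus>\<^bsub>A\<^esub> (a \<ominus>\<^bsub>A\<^esub> b)" if "a \<in> carrier A" "b \<in> carrier A" for a b
        using that A.M.r_neg1[of b "\<ominus>\<^bsub>A\<^esub> a"] A.M.a_comm[of "\<ominus>\<^bsub>A\<^esub> a" b]
        by (simp add: A.M.minus_eq A.M.minus_add)
      have "f (X, Y) = \<ominus>\<^bsub>A\<^esub> \<epsilon> (\<mu> (X \<stileturn>\<^bsub>Q\<^esub> Y)) \<oplus>\<^bsub>A\<^esub> \<ominus>\<^bsub>A\<^esub> \<epsilon> (\<mu> X \<stileturn>\<^bsub>L\<^esub> \<mu> Y \<ominus>\<^bsub>L\<^esub> \<mu> (X \<stileturn>\<^bsub>Q\<^esub> Y))"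
        "g (X, Y) = \<ominus>\<^bsub>A\<^esub> \<epsilon> (\<mu> (X \<turnstile>\<^bsub>Q\<^esub> Y)) \<oplus>\<^bsub>A\<^esub> \<ominus>\<^bsub>A\<^esub> \<epsilon> (\<mu> X \<turnstile>\<^bsub>L\<^esub> \<mu> Y \<ominus>\<^bsub>L\<^esub> \<mu> (X \<turnstile>\<^bsub>Q\<^esub> Y))"
        if "X \<in> carrier Q" "Y \<in> carrier Q" for X Y
        using that cancel[of "\<epsilon> (\<mu> X \<stileturn>\<^bsub>L\<^esub> \<mu> Y)" "\<epsilon> (\<mu> (X \<stileturn>\<^bsub>Q\<^esub> Y))"]
          cancel[of "\<epsilon> (\<mu> X \<turnstile>\<^bsub>L\<^esub> \<mu> Y)" "\<epsilon> (\<mu> (X \<turnstile>\<^bsub>Q\<^esub> Y))"]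
        by (simp_all add: f g \<epsilon>.map_minus)
      then show ?thesis
        using ext
        by (auto simp: fg Z2_def coboundary_def section_cocycle_def extend_by_section_def \<chi>_def
            compose_def \<beta>_prod fun_eq_iff extensional_def section_diff_in_ideal)
    qed
    moreover have "coboundary Q A ?\<kappa> \<in> B2 F Q A"
      using linear_maps_compose[OF CQ.B.vec_space_axioms \<mu>.linear \<epsilon>] by (simp add: CQ.B2_eq)
    ultimately have "\<phi> \<in> B2 F Q A +>\<^bsub>Z2 F Q A\<^esub> ?c"
      by (auto simp: a_r_coset_def')
    then have "X = Tra F L H \<mu> A \<chi>"
      unfolding X Tra_eq[OF \<chi>]
      using CQ.Z2.a_repr_independence'[of \<phi> ?c] section_cocycle_closed[OF extend_by_section_linear[OF \<chi>_lin]]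
      by simp
    with \<chi> show "X \<in> Tra F L H \<mu> A ` carrier (Hom F K A)"
      by (intro image_eqI[of X "Tra F L H \<mu> A" \<chi>])
  qed
qed

end

theorem theorem3p1:
  fixes F :: "('f, 'r) ring_scheme"
    and L :: "('f, 'l, 'm) dialgebra_scheme"
    and H :: "'l set"
    and \<mu> :: "'l set \<Rightarrow> 'l"
    and A :: "('f, 'a) module"
  assumes "diassociative_algebra F L"
    and "central_ideal H F L"
    and "is_section F L H \<mu>"
    and "vec_space F A"
  shows
    "exact_at F zero_module (\<lambda>_\<in>carrier zero_module. \<zero>\<^bsub>Hom F (FactDialgebra L H) A\<^esub>)
       (Hom F (FactDialgebra L H) A) (Inf1 F L H A) (Hom F L A) \<and>
     exact_at F (Hom F (FactDialgebra L H) A) (Inf1 F L H A)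
       (Hom F L A) (Res F L H A) (Hom F (L\<lparr>carrier := H\<rparr>) A) \<and>
     exact_at F (Hom F L A) (Res F L H A)
       (Hom F (L\<lparr>carrier := H\<rparr>) A) (Tra F L H \<mu> A) (H2 F (FactDialgebra L H) A) \<and>
     exact_at F (Hom F (L\<lparr>carrier := H\<rparr>) A) (Tra F L H \<mu> A)
       (H2 F (FactDialgebra L H) A) (Inf2 F L H A) (H2 F L A)"
proof -
  interpret central_extension F L H A \<mu>
    using assms
    by (simp add: central_extension_def central_extension_axioms_def quotient_dialgebra_def
        central_ideal_def central_ideal_axioms_def)
  show ?thesis
    by (intro conjI exact_Hom_quotient exact_Hom exact_Hom_ideal exact_H2_quotient)
qed

end
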